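(* Consider the linear model with unpenalized intercept, $y_i=x_i\beta^*+\sigma^*\xi_i$, $i=1,\dots,n$, with $\sigma^*=1$, and the exp-Lasso estimator $(\hat\beta,\hat\sigma)$ with tuning parameter $\lambda$ in which the intercept is not penalized, as described in the context. Let $s^*:=\#\{j\ge 2:\beta_j^*\ne0\}$. Assume: (1) $\xi_1,\xi_2,\dots$ are i.i.d. copies of a random variable $\xi$ with known density $f$ (not depending on $n$), $f>0$ everywhere, $l:=-\log f$ is convex and differentiable with derivative $\dot l$, and $|\mathbb E\, l(\xi)|<\infty$, $\mathbb E(\dot l(\xi))^2<\infty$, $\mathbb E(\dot l(\xi)\xi)^2<\infty$. (2) The $x_i$ are non-random and $\max_{i,j}|x_{i,j}|\le K_{\rm x}$, where $K_{\rm x}\ge1$. (3) There is a function $G>0$ with $\mathbb E G^2(\xi)<\infty$ and $\mathbb E G^2(\xi)\xi^4<\infty$ such that for all $M>0$ small enough, $|\dot l(\xi+y)-\dot l(\xi+\tilde y)|\le G(\xi)|y-\tilde y|$ for all $y,\tilde y$ with $|y|\vee|\tilde y|\le (K_{\rm x}+|\xi|)M$. (4) The function $H(c,d):=\mathbb E\, l(d\xi-c)$, $(c,d)\in\mathbb R\times(0,\infty)$, has for $|c|+|d-1|$ small enough a Hessian $\ddot H(c,d)$ which is continuous there, and $\ddot H(0,1)$ is positive definite. (5) $p\to\infty$ and $\log p/n\to0$. (6) For some matrix $\Sigma\in\mathbb R^{p\times p}$ with smallest eigenvalue $\Lambda_{\rm x}^2>0$ not depending on $n$, $\max_{j,k}|\hat\Sigma_{j,k}-\Sigma_{j,k}|\lesssim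 K_{\rm x}^2\sqrt{\log p/n}$. (7) Either $\alpha\in(0,1/2)$ is fixed (not depending on $n$) or $\alpha=1/p$, and $F^{-1}(1-\alpha)\asymp\sqrt{\log p/n}$, where $F$ is the distribution of $\lambda^*$. (8) $s^*\le s_{\max}$, where $1\le s_{\max}\ll\Lambda_{\rm x}^2\sqrt{n/\log p}/K_{\rm x}^2$. (9) $\sum_{i=1}^nx_{i,j}=0$ for $j=2,\dots,p$. (10) $0<\eta<1$, $1-\eta\gtrsim1$, $\eta^2\gg s_{\max}\sqrt{\log p/n}\,K_{\rm x}^2/\Lambda_{\rm x}^2$, $\lambda\asymp\sqrt{\log p/n}$ and $\lambda\ge F^{-1}(1-\alpha)/(1-\eta)$. Then under $H_0:\ \beta^*_{-0}=0$, it holds that $\hat\beta_{-0}=0$ with probability at least $1-\alpha+o(1)$.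
   Context: Model: $x_i=(1,x_{i,2},\dots,x_{i,p})\in\mathbb R^p$ is a row vector whose first entry is $1$ (intercept), $y_i=x_i\beta^*+\sigma^*\xi_i$, with $\beta^*\in\mathbb R^p$ an unknown column vector and $\sigma^*>0$. Write $\beta=(\beta_0,\beta_{-0}^T)^T$ where $\beta_0:=\beta_1$ is the intercept and $\beta_{-0}:=(\beta_2,\dots,\beta_p)^T$. $\hat\Sigma:=\frac1n\sum_{i=1}^n x_i^Tx_i$. $R_n(\beta,\sigma):=\frac1n\sum_{i=1}^n\bigl[l\bigl(\frac{y_i-x_i\beta}{\sigma}\bigr)+\log\sigma\bigr]$. Exp-Lasso with unpenalized intercept: $(\hat\beta,\hat\sigma)\in\arg\min_{\beta\in\mathbb R^p,\ \sigma>0}\{\exp[R_n(\beta,\sigma)]+\lambda\|\beta_{-0}\|_1\}$. $\lambda^*:=\bigl\|\frac1n\sum_{i=1}^n\dot l(\xi_i)x_i\bigr\|_\infty\exp\bigl[-\frac1n\sum_{i=1}^n\log f(\xi_i)\bigr]$; $F$ is its distribution function and $F^{-1}$ its quantile function. Asymptotics: limits are for $n\to\infty$. The quantities $p,x_i,\beta^*,K_{\rm x},\Sigma,s_{\max},\alpha,\eta,\lambda$ may depend on $n$; $f$ does not. For positive sequences, $u\lesssim v$ (equivalently $v\gtrsim u$) means $\limsup u_n/v_n<\infty$; $u\asymp v$ means $u\lesssim v$ and $v\lesssim u$; $u\ll v$ or $v\gg u$ means $u_n/v_n\to0$. "For $M$ small enough" means for all $0<M\le M_0$ for some $M_0>0$.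 *)

(* Conventions.  All indices start at 0: observations are i < n, coordinates are j < p, and
   j = 0 is the intercept, so that beta_{-0} consists of the coordinates j in {1..<p}.
   The dimension p varies with n, so an element of R^p is represented by a function
   nat => real; only its values at j < p are ever used. *)
theory Defs
  imports "HOL-Probability.Probability" "Jordan_Normal_Form.Char_Poly"
begin

(* Cartesian vectors real^'n are used below only for the two-dimensional argument (c, d) of
   the function H; the symbols $ and \<bullet> are left to them. *)
no_notation vec_index (infixl "$" 100) and scalar_prod (infix "\<bullet>" 70)

(* For sequences that are positive, as they are for all large n.  The positivity clause
   excludes the value u / 0 = 0. *)
definition asymp_lesssim :: "(nat \<Rightarrow> real) \<Rightarrow> (nat \<Rightarrow> real) \<Rightarrow> bool" where
  "asymp_lesssim u v \<longleftrightarrow>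
     (\<forall>\<^sub>F n in sequentially. 0 < v n) \<and> limsup (\<lambda>n. ereal (u n / v n)) < \<infinity>"

definition asymp_equiv_order :: "(nat \<Rightarrow> real) \<Rightarrow> (nat \<Rightarrow> real) \<Rightarrow> bool" where
  "asymp_equiv_order u v \<longleftrightarrow> asymp_lesssim u v \<and> asymp_lesssim v u"

definition asymp_ll :: "(nat \<Rightarrow> real) \<Rightarrow> (nat \<Rightarrow> real) \<Rightarrow> bool" where
  "asymp_ll u v \<longleftrightarrow>
     (\<forall>\<^sub>F n in sequentially. 0 < v n) \<and> (\<lambda>n. u n / v n) \<longlonglongrightarrow> 0"

definition neg_log :: "(real \<Rightarrow> real) \<Rightarrow> real \<Rightarrow> real" where
  "neg_log f t = - ln (f t)"

definition lin_pred :: "nat \<Rightarrow> (nat \<Rightarrow> real) \<Rightarrow> (nat \<Rightarrow> real) \<Rightarrow> real" where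
  "lin_pred p xi \<beta> = (\<Sum>j<p. xi j * \<beta> j)"

definition emp_risk ::
  "(real \<Rightarrow> real) \<Rightarrow> nat \<Rightarrow> nat \<Rightarrow> (nat \<Rightarrow> nat \<Rightarrow> real) \<Rightarrow> (nat \<Rightarrow> real) \<Rightarrow> (nat \<Rightarrow> real) \<Rightarrow> real \<Rightarrow> real"
  where
  "emp_risk l n p x y \<beta> \<sigma> =
     (1 / real n) * (\<Sum>i<n. (l ((y i - lin_pred p (x i) \<beta>) / \<sigma>) + ln \<sigma>))"

definition exp_lasso_objective ::
  "(real \<Rightarrow> real) \<Rightarrow> nat \<Rightarrow> nat \<Rightarrow> (nat \<Rightarrow> nat \<Rightarrow> real) \<Rightarrow> (nat \<Rightarrow> real) \<Rightarrow> real
     \<Rightarrow> (nat \<Rightarrow> real) \<times> real \<Rightarrow> real"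
  where
  "exp_lasso_objective l n p x y lam =
     (\<lambda>(\<beta>, \<sigma>). exp (emp_risk l n p x y \<beta> \<sigma>) + lam * (\<Sum>j\<in>{1..<p}. \<bar>\<beta> j\<bar>))"

definition is_exp_lasso ::
  "(real \<Rightarrow> real) \<Rightarrow> nat \<Rightarrow> nat \<Rightarrow> (nat \<Rightarrow> nat \<Rightarrow> real) \<Rightarrow> (nat \<Rightarrow> real) \<Rightarrow> real
     \<Rightarrow> (nat \<Rightarrow> real) \<times> real \<Rightarrow> bool"
  where
  "is_exp_lasso l n p x y lam =
     is_arg_min (exp_lasso_objective l n p x y lam) (\<lambda>(\<beta>, \<sigma>). 0 < \<sigma>)"

definition emp_gram :: "nat \<Rightarrow> nat \<Rightarrow> (nat \<Rightarrow> nat \<Rightarrow> real) \<Rightarrow> real mat" where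
  "emp_gram n p x = mat p p (\<lambda>(j, k). (1 / real n) * (\<Sum>i<n. x i j * x i k))"

definition max_abs_entry :: "nat \<Rightarrow> real mat \<Rightarrow> real" where
  "max_abs_entry p A = Max ((\<lambda>(j, k). \<bar>A $$ (j, k)\<bar>) ` ({..<p} \<times> {..<p}))"

definition smallest_eigenvalue :: "real mat \<Rightarrow> real \<Rightarrow> bool" where
  "smallest_eigenvalue A \<mu> \<longleftrightarrow> eigenvalue A \<mu> \<and> (\<forall>\<nu>. eigenvalue A \<nu> \<longrightarrow> \<mu> \<le> \<nu>)"

(* e is the noise vector (xi_i). *)
definition lambda_star ::
  "(real \<Rightarrow> real) \<Rightarrow> nat \<Rightarrow> nat \<Rightarrow> (nat \<Rightarrow> nat \<Rightarrow> real) \<Rightarrow> (nat \<Rightarrow> real) \<Rightarrow> real" where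
  "lambda_star f n p x e =
     Max ((\<lambda>j. \<bar>(1 / real n) * (\<Sum>i<n. deriv (neg_log f) (e i) * x i j)\<bar>) ` {..<p})
       * exp (- (1 / real n) * (\<Sum>i<n. ln (f (e i))))"

definition quantile_fun :: "(real \<Rightarrow> real) \<Rightarrow> real \<Rightarrow> real" where
  "quantile_fun F u = Inf {t. u \<le> F t}"

definition expected_nll :: "(real \<Rightarrow> real) \<Rightarrow> real^2 \<Rightarrow> real" where
  "expected_nll f z = (\<integral>t. neg_log f (z $ 2 * t - z $ 1) \<partial>density lborel f)"

(* A is the Jacobian at z of the gradient of F; the gradient has to exist near z. *)
definition has_hessian :: "(real^'n \<Rightarrow> real) \<Rightarrow> real^'n^'n \<Rightarrow> real^'n \<Rightarrow> bool" where
  "has_hessian F A z \<longleftrightarrow>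
     (\<exists>g. (\<forall>\<^sub>F w in nhds z. (F has_derivative (\<lambda>h. g w \<bullet> h)) (at w)) \<and>
          (g has_derivative (\<lambda>h. A *v h)) (at z))"

definition positive_definite :: "real^'n^'n \<Rightarrow> bool" where
  "positive_definite A \<longleftrightarrow> (\<forall>h. h \<noteq> 0 \<longrightarrow> 0 < h \<bullet> (A *v h))"

end

(* The objective in (beta, sigma) is sigma * exp(convex function of (1/sigma, beta/sigma)) plus a
   norm.  Using exp u >= 1 + u and the tangents of l, a stationary point (c, d) of the
   two-parameter location-scale risk  mean l(d xi - c) - log d  therefore yields a global
   minimiser with beta_{-0} = 0, and forces beta_{-0} = 0 in every minimiser, as soon as
   exp(mean l(d xi - c)) * |mean l'(d xi - c) x_j| < lambda for all j >= 1.

   At (c, d) = (0, 1) the left-hand side is at most lambda^*, which is <= (1 - eta) lambda with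
   probability at least 1 - alpha.  Hence it suffices to find the stationary point so close to
   (0, 1) that replacing it by (0, 1) costs less than eta * lambda.  Gibbs' inequality makes the
   expected score vanish at (0, 1), and the Hessian condition gives quadratic growth, so the
   empirical risk exceeds its value at (0, 1) on the boundary of a box of radius r >> n^(-1/2).
   Over this box the score fluctuates by little uniformly in j: the columns x_j are centred,
   so after truncating the Lipschitz envelope a Chernoff bound over a polynomial grid
   applies. *)
theory Submission
  imports Defs "HOL-Real_Asymp.Real_Asymp"
begin

section \<open>Optimality conditions and quadratic growth\<close>

text \<open>The envelope has only a second moment, while \<open>ln p\<close> is merely
  \<open>o(n)\<close>. Chebyshev's inequality survives a union bound over the roughly
  \<open>n^(4/5)\<close> grid points, but not one over the \<open>p\<close> columns; hence
  truncation and exponential moments for the column scores, and for them only. With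
  \<open>R = sqrt (ln p / n)\<close> the truncation level \<open>1/R\<close> balances two demands:
  the truncated terms are bounded enough for the exponential parameter \<open>R / (K r)\<close>, and
  the discarded part has mean of order \<open>r R\<close>, which after multiplication by
  \<open>K\<close> is still negligible against \<open>\<eta> * lam\<close>, because
  \<open>K r / \<eta>\<close> tends to 0. The condition on \<open>\<eta>\<close> enters as
  \<open>K / \<eta> <= n^(1/4)\<close>. This leaves room for a radius between
  \<open>n^(-1/2)\<close> and \<open>n^(-1/4)\<close>. The factor
  \<open>exp (mean l(d xi - c))\<close> is not estimated term by term: the stationary point
  minimises the risk over the box, so its risk is at most that at (0, 1), and the factor is at most
  \<open>d exp (mean l(xi))\<close>. That quantity is only bounded in probability, which is why a
  slowly diverging \<open>N\<close> accompanies every estimate.\<close>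

lemma exp_lasso_null_selection:
  fixes l \<psi> :: "real \<Rightarrow> real" and e y :: "nat \<Rightarrow> real" and x :: "nat \<Rightarrow> nat \<Rightarrow> real" and c d b0 lam :: real
  assumes convex: "convex_on UNIV l"
    and deriv: "\<And>t. (l has_real_derivative \<psi> t) (at t)"
    and n: "n \<ge> 1" and p: "p \<ge> 1" and d: "d > 0"
    and intercept: "\<And>i. i < n \<Longrightarrow> x i 0 = 1"
    and y: "\<And>i. i < n \<Longrightarrow> y i = b0 + e i"
    and score0: "(\<Sum>i<n. \<psi> (d * e i - c)) = 0"
    and score1: "(\<Sum>i<n. \<psi> (d * e i - c) * e i) = real n / d"
    and small: "\<And>j. j \<in> {1..<p} \<Longrightarrow>
      exp ((\<Sum>i<n. l (d * e i - c)) / real n) * \<bar>(\<Sum>i<n. \<psi> (d * e i - c) * x i j) / real n\<bar> < lam"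
  shows "\<exists>\<theta>. is_exp_lasso l n p x y lam \<theta>"
    and "is_exp_lasso l n p x y lam (\<beta>, \<sigma>) \<Longrightarrow> j \<in> {1..<p} \<Longrightarrow> \<beta> j = 0"
proof -
  define a where "a i = d * e i - c" for i
  define Q where "Q = (\<Sum>i<n. l (a i)) / real n"
  define g where "g j = (\<Sum>i<n. \<psi> (a i) * x i j) / real n" for j
  define obj where "obj = exp_lasso_objective l n p x y lam"
  have small': "exp Q * \<bar>g j\<bar> < lam" if "j \<in> {1..<p}" for j
    using small[OF that] by (simp add: Q_def g_def a_def)
  have n0: "real n > 0" using n by simp
  have split_lin: "lin_pred p (x i) \<beta> = \<beta> 0 + (\<Sum>j\<in>{1..<p}. x i j * \<beta> j)" if "i < n" for i \<beta>
  proof -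
    have "{..<p} = insert 0 {1..<p}" using p by auto
    then show ?thesis unfolding lin_pred_def by (simp add: intercept[OF that])
  qed
  \<comment> \<open>A bound with explicit slack: \<open>exp Q / d\<close> is the value at the
    candidate, and each penalised coordinate adds a strictly positive multiple of its modulus. It
    yields both the existence of a minimiser and the zeros of every minimiser.\<close>
  have lower: "exp Q / d + (\<Sum>j\<in>{1..<p}. (lam - exp Q * \<bar>g j\<bar>) * \<bar>\<beta> j\<bar>) \<le> obj (\<beta>, \<sigma>)"
    if \<sigma>: "\<sigma> > 0" for \<beta> \<sigma>
  proof -
    define r where "r i = (y i - lin_pred p (x i) \<beta>) / \<sigma>" for i
    define Q' where "Q' = (\<Sum>i<n. l (r i)) / real n"
    have tangent: "l (r i) \<ge> l (a i) + \<psi> (a i) * (r i - a i)" for i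
      using convex_on_imp_above_tangent[OF convex, of "a i" "r i" "\<psi> (a i)"] deriv[of "a i"] by simp
    \<comment> \<open>The two score equations combine to exactly \<open>n\<close>. The resulting
      \<open>- 1\<close> in the tangent bound for \<open>Q'\<close> cancels the \<open>1\<close> in
      \<open>exp u >= 1 + u\<close>; what remains is proportional to \<open>1 / \<sigma>\<close>,
      and multiplying by \<open>\<sigma>\<close> removes the scale.\<close>
    have s1: "(\<Sum>i<n. \<psi> (a i) * a i) = real n"
    proof -
      have "(\<Sum>i<n. \<psi> (a i) * a i) = d * (\<Sum>i<n. \<psi> (a i) * e i) - c * (\<Sum>i<n. \<psi> (a i))"
        by (simp add: a_def algebra_simps sum_distrib_left sum_subtractf)
      then show ?thesis using score0 score1 d by (simp add: a_def)
    qed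
    have s2: "(\<Sum>i<n. \<psi> (a i) * r i) = real n * ((1 / d - (\<Sum>j\<in>{1..<p}. \<beta> j * g j)) / \<sigma>)"
    proof -
      have "(\<Sum>i<n. \<psi> (a i) * r i) = (\<Sum>i<n. ((b0 - \<beta> 0) * \<psi> (a i) + \<psi> (a i) * e i
          - (\<Sum>j\<in>{1..<p}. \<beta> j * (\<psi> (a i) * x i j))) / \<sigma>)"
        by (intro sum.cong refl)
          (simp add: r_def split_lin y algebra_simps sum_distrib_left sum_distrib_right)
      also have "\<dots> = ((b0 - \<beta> 0) * (\<Sum>i<n. \<psi> (a i)) + (\<Sum>i<n. \<psi> (a i) * e i)
          - (\<Sum>i<n. \<Sum>j\<in>{1..<p}. \<beta> j * (\<psi> (a i) * x i j))) / \<sigma>"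
        by (simp add: sum_divide_distrib[symmetric] sum.distrib sum_subtractf sum_distrib_left)
      also have "(\<Sum>i<n. \<Sum>j\<in>{1..<p}. \<beta> j * (\<psi> (a i) * x i j)) = (\<Sum>j\<in>{1..<p}. real n * (\<beta> j * g j))"
        using n0 by (subst sum.swap) (simp add: g_def sum_distrib_left[symmetric])
      finally show ?thesis
        using score0 score1 n0 by (simp add: a_def sum_distrib_left[symmetric] field_simps)
    qed
    have "real n * Q' \<ge> (\<Sum>i<n. l (a i) + \<psi> (a i) * (r i - a i))"
      unfolding Q'_def using n0 by (auto intro!: sum_mono tangent)
    also have "(\<Sum>i<n. l (a i) + \<psi> (a i) * (r i - a i))
        = real n * (Q + (1 / d - (\<Sum>j\<in>{1..<p}. \<beta> j * g j)) / \<sigma> - 1)"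
      using n0 by (simp add: sum.distrib right_diff_distrib sum_subtractf s1 s2 Q_def)
         (simp add: algebra_simps)
    finally have Q': "Q' - Q + 1 \<ge> (1 / d - (\<Sum>j\<in>{1..<p}. \<beta> j * g j)) / \<sigma>"
      using n0 by simp
    have "exp Q' = exp Q * exp (Q' - Q)" by (simp add: exp_add[symmetric])
    also have "\<dots> \<ge> exp Q * ((1 / d - (\<Sum>j\<in>{1..<p}. \<beta> j * g j)) / \<sigma>)"
      using order_trans[of _ "1 + (Q' - Q)", OF _ exp_ge_add_one_self] Q'
      by (intro mult_left_mono) auto
    finally have "\<sigma> * exp Q' \<ge> \<sigma> * (exp Q * ((1 / d - (\<Sum>j\<in>{1..<p}. \<beta> j * g j)) / \<sigma>))"
      using \<sigma> by (intro mult_left_mono) auto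
    also have "\<sigma> * (exp Q * ((1 / d - (\<Sum>j\<in>{1..<p}. \<beta> j * g j)) / \<sigma>))
        = exp Q / d - (\<Sum>j\<in>{1..<p}. exp Q * (\<beta> j * g j))"
      using \<sigma> by (simp add: field_simps sum_distrib_left)
    finally have e1: "\<sigma> * exp Q' \<ge> exp Q / d - (\<Sum>j\<in>{1..<p}. exp Q * (\<beta> j * g j))" .
    have "emp_risk l n p x y \<beta> \<sigma> = Q' + ln \<sigma>"
      using n0 by (simp add: emp_risk_def Q'_def r_def sum.distrib field_simps)
    then have "obj (\<beta>, \<sigma>) = \<sigma> * exp Q' + lam * (\<Sum>j\<in>{1..<p}. \<bar>\<beta> j\<bar>)"
      using \<sigma> by (simp add: obj_def exp_lasso_objective_def exp_add)
    moreover have "(\<Sum>j\<in>{1..<p}. (lam - exp Q * \<bar>g j\<bar>) * \<bar>\<beta> j\<bar>)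
        \<le> (\<Sum>j\<in>{1..<p}. lam * \<bar>\<beta> j\<bar> - exp Q * (\<beta> j * g j))"
    proof (intro sum_mono)
      fix j
      have "exp Q * (\<beta> j * g j) \<le> exp Q * (\<bar>g j\<bar> * \<bar>\<beta> j\<bar>)"
        by (intro mult_left_mono) (auto simp: abs_mult[symmetric] mult.commute)
      then show "(lam - exp Q * \<bar>g j\<bar>) * \<bar>\<beta> j\<bar> \<le> lam * \<bar>\<beta> j\<bar> - exp Q * (\<beta> j * g j)"
        by (simp add: algebra_simps)
    qed
    ultimately show ?thesis using e1 by (simp add: sum_subtractf sum_distrib_left)
  qed
  \<comment> \<open>With intercept \<open>b0 + c / d\<close> and scale \<open>1 / d\<close> the
    standardised residuals are \<open>d * e i - c\<close>.\<close>
  define \<beta>0 where "\<beta>0 j = (if j = 0 then b0 + c / d else 0)" for j :: nat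
  have opt: "obj (\<beta>0, 1 / d) = exp Q / d"
  proof -
    have "(y i - lin_pred p (x i) \<beta>0) / (1 / d) = a i" if "i < n" for i
      using d that by (simp add: y split_lin \<beta>0_def a_def field_simps)
    then have "emp_risk l n p x y \<beta>0 (1 / d) = Q + ln (1 / d)"
      using n0 by (simp add: emp_risk_def Q_def sum.distrib field_simps)
    then show ?thesis using d
      by (simp add: obj_def exp_lasso_objective_def exp_add \<beta>0_def ln_div exp_diff)
  qed
  have nonneg: "0 \<le> (lam - exp Q * \<bar>g j\<bar>) * \<bar>\<beta> j\<bar>" if "j \<in> {1..<p}" for j \<beta>
    using small'[OF that] by simp
  have "is_exp_lasso l n p x y lam (\<beta>0, 1 / d)"
    unfolding is_exp_lasso_def is_arg_min_def obj_def[symmetric]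
  proof (safe)
    show "0 < 1 / d" using d by simp
    fix \<beta> and \<sigma> :: real assume "0 < \<sigma>" "obj (\<beta>, \<sigma>) < obj (\<beta>0, 1 / d)"
    moreover have "(\<Sum>j\<in>{1..<p}. (lam - exp Q * \<bar>g j\<bar>) * \<bar>\<beta> j\<bar>) \<ge> 0"
      by (intro sum_nonneg nonneg)
    ultimately show False using lower[of \<sigma> \<beta>] opt by linarith
  qed
  then show "\<exists>\<theta>. is_exp_lasso l n p x y lam \<theta>" by blast
  show "\<beta> j = 0" if min: "is_exp_lasso l n p x y lam (\<beta>, \<sigma>)" and j: "j \<in> {1..<p}" for \<beta> \<sigma> j
  proof -
    have "\<sigma> > 0 \<and> (\<forall>\<beta>' \<sigma>'. \<sigma>' \<le> 0 \<or> obj (\<beta>, \<sigma>) \<le> obj (\<beta>', \<sigma>'))"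
      using min unfolding is_exp_lasso_def is_arg_min_def obj_def[symmetric] by (auto simp: not_less)
    moreover have "\<not> 1 / d \<le> 0" using d by simp
    ultimately have \<sigma>: "\<sigma> > 0" and le: "obj (\<beta>, \<sigma>) \<le> obj (\<beta>0, 1 / d)" by blast+
    have "(lam - exp Q * \<bar>g j\<bar>) * \<bar>\<beta> j\<bar> \<le> (\<Sum>j\<in>{1..<p}. (lam - exp Q * \<bar>g j\<bar>) * \<bar>\<beta> j\<bar>)"
      by (rule member_le_sum[OF j nonneg]) auto
    also have "\<dots> \<le> 0" using lower[OF \<sigma>, of \<beta>] le opt by linarith
    finally show ?thesis using small'[OF j] by (simp add: mult_le_0_iff)
  qed
qed

text \<open>This is \<open>R_n\<close> for data \<open>b0 + e i\<close> at zero slopes, intercept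
  \<open>b0 + c / d\<close> and \<open>\<sigma> = 1 / d\<close>; the term \<open>- ln d\<close> is
  \<open>ln \<sigma>\<close>.\<close>

definition profile_risk :: "(real \<Rightarrow> real) \<Rightarrow> nat \<Rightarrow> (nat \<Rightarrow> real) \<Rightarrow> real \<Rightarrow> real \<Rightarrow> real" where
  "profile_risk l n e c d = (\<Sum>i<n. l (d * e i - c)) / real n - ln d"

text \<open>A minimiser over the closed box exists by compactness and cannot lie on the boundary,
  where the risk exceeds its value at the centre, so both partial derivatives vanish there. The
  radius \<open>r < 1\<close> keeps \<open>d\<close> positive. The risk comparison is returned as
  well because it later controls the exponential of the mean loss.\<close>

lemma profile_risk_stationary_point:
  assumes deriv: "\<And>t. (l has_real_derivative \<psi> t) (at t)"
    and n: "n \<ge> 1" and r: "0 < r" "r < 1"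
    and boundary: "\<And>c d. max \<bar>c\<bar> \<bar>d - 1\<bar> = r \<Longrightarrow> profile_risk l n e 0 1 < profile_risk l n e c d"
  obtains c d where "\<bar>c\<bar> < r" "\<bar>d - 1\<bar> < r" "profile_risk l n e c d \<le> profile_risk l n e 0 1"
    "(\<Sum>i<n. \<psi> (d * e i - c)) = 0" "(\<Sum>i<n. \<psi> (d * e i - c) * e i) = real n / d"
proof -
  define K where "K = {-r..r} \<times> {1 - r..1 + r}"
  define F where "F z = profile_risk l n e (fst z) (snd z)" for z
  have [continuous_intros]: "continuous_on A l" for A
    using deriv by (meson DERIV_continuous_on has_field_derivative_at_within)
  have l_comp: "continuous_on A (\<lambda>z. l (h z))" if "continuous_on A h" for h :: "real \<times> real \<Rightarrow> real" and A
    by (rule continuous_on_compose2[of UNIV l, OF _ that]) (auto intro: continuous_intros)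
  have "continuous_on K F"
    unfolding F_def profile_risk_def using r n
    by (intro continuous_intros l_comp) (auto simp: K_def)
  moreover have "compact K" unfolding K_def by (intro compact_Times) auto
  moreover have "(0, 1) \<in> K" using r by (auto simp: K_def)
  ultimately obtain z where z: "z \<in> K" "\<And>w. w \<in> K \<Longrightarrow> F z \<le> F w"
    using continuous_attains_inf[of K F] by blast
  define c d where "c = fst z" and "d = snd z"
  have le: "profile_risk l n e c d \<le> profile_risk l n e 0 1"
    using z(2)[OF \<open>(0, 1) \<in> K\<close>] by (simp add: F_def c_def d_def)
  have box: "\<bar>c\<bar> \<le> r" "\<bar>d - 1\<bar> \<le> r" using z(1) by (auto simp: K_def c_def d_def abs_le_iff)
  have "max \<bar>c\<bar> \<bar>d - 1\<bar> \<noteq> r" using boundary[of c d] le by auto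
  then have int: "\<bar>c\<bar> < r" "\<bar>d - 1\<bar> < r" using box by (auto simp: max_def split: if_splits)
  then have d: "d > 0" using r by linarith
  define \<epsilon> where "\<epsilon> = min (r - \<bar>c\<bar>) (r - \<bar>d - 1\<bar>)"
  have \<epsilon>: "\<epsilon> > 0" using int by (simp add: \<epsilon>_def)
  have mc: "\<forall>c'. \<bar>c - c'\<bar> < \<epsilon> \<longrightarrow> profile_risk l n e c d \<le> profile_risk l n e c' d"
  proof (intro allI impI)
    fix c' assume "\<bar>c - c'\<bar> < \<epsilon>"
    then have "(c', d) \<in> K" using box by (auto simp: K_def \<epsilon>_def)
    from z(2)[OF this] show "profile_risk l n e c d \<le> profile_risk l n e c' d"
      by (simp add: F_def c_def d_def)
  qed
  have md: "\<forall>d'. \<bar>d - d'\<bar> < \<epsilon> \<longrightarrow> profile_risk l n e c d \<le> profile_risk l n e c d'"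
  proof (intro allI impI)
    fix d' assume "\<bar>d - d'\<bar> < \<epsilon>"
    then have "(c, d') \<in> K" using box by (auto simp: K_def \<epsilon>_def)
    from z(2)[OF this] show "profile_risk l n e c d \<le> profile_risk l n e c d'"
      by (simp add: F_def c_def d_def)
  qed
  have dl: "((\<lambda>w. l (h w)) has_real_derivative \<psi> (h w) * h') (at w)"
    if "(h has_real_derivative h') (at w)" for h h' w
    using DERIV_chain2[OF deriv that] .
  have "((\<lambda>c. profile_risk l n e c d) has_real_derivative (\<Sum>i<n. \<psi> (d * e i - c) * (-1)) / real n) (at c)"
    unfolding profile_risk_def using n by (auto intro!: derivative_eq_intros dl)
  from DERIV_local_min[OF this \<epsilon> mc] have s0: "(\<Sum>i<n. \<psi> (d * e i - c)) = 0"
    using n by (simp add: sum_negf)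
  have "((\<lambda>d. profile_risk l n e c d) has_real_derivative
      (\<Sum>i<n. \<psi> (d * e i - c) * e i) / real n - 1 / d) (at d)"
    unfolding profile_risk_def using d n by (auto intro!: derivative_eq_intros dl)
  from DERIV_local_min[OF this \<epsilon> md] have s1: "(\<Sum>i<n. \<psi> (d * e i - c) * e i) = real n / d"
    using n d by (simp add: field_simps)
  show ?thesis using that[OF int le s0 s1] .
qed

text \<open>Near 0 a linear term dominates a quadratic one, and \<open>s\<close> may take either
  sign. This yields first-order conditions without differentiating under the expectation.\<close>

lemma linear_coeff_zero:
  fixes a C \<delta> :: real
  assumes \<delta>: "\<delta> > 0" and bound: "\<And>s. \<bar>s\<bar> < \<delta> \<Longrightarrow> 0 \<le> s * a + C * s\<^sup>2"
  shows "a = 0"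
proof (rule ccontr)
  assume a: "a \<noteq> 0"
  define C' where "C' = \<bar>C\<bar> + 1"
  \<comment> \<open>The step is so short that the quadratic term is at most half of the linear one;
    \<open>C' >= 1\<close> makes the division safe whatever the sign of \<open>C\<close>.\<close>
  define s where "s = min (\<delta> / 2) (\<bar>a\<bar> / (2 * C'))"
  have C': "C' > 0" "C \<le> C'" by (auto simp: C'_def)
  have s: "s > 0" "s < \<delta>" "s \<le> \<bar>a\<bar> / (2 * C')" using \<delta> a C' by (auto simp: s_def)
  have "0 \<le> - s * \<bar>a\<bar> + C * s\<^sup>2"
  proof (cases "a > 0")
    case True
    then show ?thesis using bound[of "- s"] s by simp
  next
    case False
    then show ?thesis using bound[of s] s by simp
  qed
  also have "\<dots> \<le> - s * \<bar>a\<bar> + C' * s\<^sup>2" using C' by (auto intro: mult_right_mono)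
  also have "\<dots> = s * (C' * s - \<bar>a\<bar>)" by (simp add: algebra_simps power2_eq_square)
  finally have "C' * s \<ge> \<bar>a\<bar>" using s by (simp add: zero_le_mult_iff)
  moreover have "C' * s \<le> \<bar>a\<bar> / 2" using s(3) C' by (simp add: field_simps)
  ultimately show False using a by simp
qed

text \<open>The gradient is known to be differentiable at \<open>z\<close> only, so the argument
  runs along the segment from \<open>z\<close> to \<open>z + h\<close>: subtracting the linear part
  and a small multiple of the squared length leaves a function \<open>\<phi>\<close> with
  nonnegative derivative. The vector \<open>g\<close> is the gradient at \<open>z\<close>, which
  need not vanish.\<close>

lemma positive_definite_hessian_growth:
  fixes F :: "real^'n \<Rightarrow> real"
  assumes "has_hessian F A z" "positive_definite A"
  obtains g \<kappa> \<delta> where "\<kappa> > 0" "\<delta> > 0"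
    "\<And>h. norm h < \<delta> \<Longrightarrow> \<kappa> * (norm h)\<^sup>2 \<le> F (z + h) - F z - g \<bullet> h"
proof -
  obtain g where g1: "\<forall>\<^sub>F w in nhds z. (F has_derivative (\<lambda>h. g w \<bullet> h)) (at w)"
    and g2: "(g has_derivative (\<lambda>h. A *v h)) (at z)"
    using assms(1) unfolding has_hessian_def by blast
  have "continuous_on (sphere 0 1) (\<lambda>h. h \<bullet> (A *v h))"
    by (intro continuous_intros)
  moreover have "sphere (0::real^'n) 1 \<noteq> {}" by simp
  ultimately obtain h0 where h0: "h0 \<in> sphere 0 1" "\<And>h. h \<in> sphere 0 1 \<Longrightarrow> h0 \<bullet> (A *v h0) \<le> h \<bullet> (A *v h)"
    using continuous_attains_inf[of "sphere 0 1" "\<lambda>h. h \<bullet> (A *v h)"] by auto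
  define m where "m = h0 \<bullet> (A *v h0)"
  have m: "m > 0" proof -
    have "h0 \<noteq> 0" using h0(1) by auto
    then show ?thesis using assms(2) unfolding m_def positive_definite_def by blast
  qed
  have quad: "m * (norm h)\<^sup>2 \<le> h \<bullet> (A *v h)" for h
  proof (cases "h = 0")
    case False
    have "m \<le> (h /\<^sub>R norm h) \<bullet> (A *v (h /\<^sub>R norm h))"
      unfolding m_def by (rule h0(2)) (use False in simp)
    also have "\<dots> = (h \<bullet> (A *v h)) / (norm h)\<^sup>2"
      by (simp add: matrix_vector_mult_scaleR power2_eq_square divide_inverse)
    finally show ?thesis using False by (simp add: field_simps)
  qed simp
  obtain \<delta>1 where \<delta>1: "\<delta>1 > 0" "\<And>w. dist w z < \<delta>1 \<Longrightarrow> (F has_derivative (\<lambda>h. g w \<bullet> h)) (at w)"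
    using g1 unfolding eventually_nhds_metric by blast
  \<comment> \<open>The quadratic form contributes \<open>m\<close> to the derivative of
    \<open>\<phi>\<close>, in units of \<open>t * (norm h)^2\<close>; the linearisation error takes
    \<open>m / 4\<close> and the subtracted square \<open>m / 2\<close>, so \<open>m / 4\<close> is
    left.\<close>
  have "m / 4 > 0" using m by simp
  then obtain \<delta>2 where \<delta>2: "\<delta>2 > 0"
    "\<And>w. norm (w - z) < \<delta>2 \<Longrightarrow> norm (g w - g z - A *v (w - z)) \<le> m / 4 * norm (w - z)"
    using g2 unfolding has_derivative_at_alt by blast
  have main: "m / 4 * (norm h)\<^sup>2 \<le> F (z + h) - F z - g z \<bullet> h" if h: "norm h < min \<delta>1 \<delta>2" for h
  proof -
    define \<phi> where "\<phi> t = F (z + t *\<^sub>R h) - t * (g z \<bullet> h) - m / 4 * (norm h)\<^sup>2 * t\<^sup>2" for t :: real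
    have "\<exists>D. (\<phi> has_real_derivative D) (at t) \<and> 0 \<le> D" if t: "0 \<le> t" "t \<le> 1" for t
    proof -
      have nt: "norm (t *\<^sub>R h) \<le> norm h" using t by (simp add: mult_left_le_one_le)
      have Fd: "(F has_derivative (\<lambda>h'. g (z + t *\<^sub>R h) \<bullet> h')) (at (z + t *\<^sub>R h))"
        by (rule \<delta>1(2)) (use h nt in \<open>simp add: dist_norm\<close>)
      have line: "((\<lambda>t. z + t *\<^sub>R h) has_derivative (\<lambda>s. s *\<^sub>R h)) (at t)"
        by (auto intro!: derivative_eq_intros)
      have "((\<lambda>t. F (z + t *\<^sub>R h)) has_derivative (\<lambda>s. g (z + t *\<^sub>R h) \<bullet> (s *\<^sub>R h))) (at t)"
        using has_derivative_compose[OF line Fd] .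
      then have "((\<lambda>t. F (z + t *\<^sub>R h)) has_real_derivative (g (z + t *\<^sub>R h) \<bullet> h)) (at t)"
        by (rule has_derivative_imp_has_field_derivative) (simp add: mult.commute)
      then have D: "(\<phi> has_real_derivative
          (g (z + t *\<^sub>R h) \<bullet> h - g z \<bullet> h - m / 4 * (norm h)\<^sup>2 * (2 * t))) (at t)"
        unfolding \<phi>_def by (auto intro!: derivative_eq_intros)
      have "norm (g (z + t *\<^sub>R h) - g z - A *v (t *\<^sub>R h)) \<le> m / 4 * norm (t *\<^sub>R h)"
        using \<delta>2(2)[of "z + t *\<^sub>R h"] h nt by simp
      then have "\<bar>(g (z + t *\<^sub>R h) - g z - A *v (t *\<^sub>R h)) \<bullet> h\<bar> \<le> m / 4 * norm (t *\<^sub>R h) * norm h"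
        using Cauchy_Schwarz_ineq2[of "g (z + t *\<^sub>R h) - g z - A *v (t *\<^sub>R h)" h]
        by (meson mult_right_mono norm_ge_zero order_trans)
      then have "\<bar>g (z + t *\<^sub>R h) \<bullet> h - g z \<bullet> h - t * (h \<bullet> (A *v h))\<bar> \<le> t * (m / 4 * (norm h)\<^sup>2)"
        using t by (simp add: inner_diff_left matrix_vector_mult_scaleR power2_eq_square
            inner_commute[of "A *v h" h] mult_ac)
      moreover have "t * (m * (norm h)\<^sup>2) \<le> t * (h \<bullet> (A *v h))"
        using quad[of h] t by (intro mult_left_mono) auto
      moreover have "0 \<le> t * (m * (norm h)\<^sup>2)" using t m by simp
      ultimately have "0 \<le> g (z + t *\<^sub>R h) \<bullet> h - g z \<bullet> h - m / 4 * (norm h)\<^sup>2 * (2 * t)"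
        by (simp add: algebra_simps, linarith)
      with D show ?thesis by blast
    qed
    from DERIV_nonneg_imp_nondecreasing[of 0 1 \<phi>, OF _ this] have "\<phi> 0 \<le> \<phi> 1" by simp
    then show ?thesis by (simp add: \<phi>_def)
  qed
  show ?thesis by (rule that[of "m / 4" "min \<delta>1 \<delta>2" "g z"]) (use m \<delta>1 \<delta>2 main in auto)
qed

section \<open>The noise distribution\<close>

text \<open>The Lipschitz range is \<open>1 + \<bar>t\<bar>\<close> and does not involve the design:
  only the displacements \<open>(d - 1) * t - c\<close> occur, and these are at most
  \<open>1 + \<bar>t\<bar>\<close> times the distance from \<open>(c, d)\<close> to (0, 1) in the
  maximum norm. The bound \<open>m0 < 1\<close> keeps \<open>d\<close> positive throughout the
  box.\<close>

locale regular_noise =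
  fixes f G :: "real \<Rightarrow> real" and m0 :: real
  assumes f_measurable [measurable]: "f \<in> borel_measurable borel"
    and prob: "prob_space (density lborel f)"
    and f_pos: "\<And>t. f t > 0"
    and convex: "convex_on UNIV (neg_log f)"
    and differentiable: "\<And>t. neg_log f field_differentiable (at t)"
    and moment_l: "integrable (density lborel f) (neg_log f)"
    and moment_dl: "integrable (density lborel f) (\<lambda>t. (deriv (neg_log f) t)\<^sup>2)"
    and moment_dl_id: "integrable (density lborel f) (\<lambda>t. (deriv (neg_log f) t * t)\<^sup>2)"
    and G_pos: "\<And>t. G t > 0"
    and moment_G: "integrable (density lborel f) (\<lambda>t. (G t)\<^sup>2)"
    and moment_G_id: "integrable (density lborel f) (\<lambda>t. (G t)\<^sup>2 * t ^ 4)"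
    and m0: "0 < m0" "m0 < 1"
    and lipschitz: "\<And>t u v. max \<bar>u\<bar> \<bar>v\<bar> \<le> (1 + \<bar>t\<bar>) * m0 \<Longrightarrow>
      \<bar>deriv (neg_log f) (t + u) - deriv (neg_log f) (t + v)\<bar> \<le> G t * \<bar>u - v\<bar>"
begin

abbreviation l :: "real \<Rightarrow> real" where "l \<equiv> neg_log f"
abbreviation \<psi> :: "real \<Rightarrow> real" where "\<psi> \<equiv> deriv l"
abbreviation \<mu> :: "real measure" where "\<mu> \<equiv> density lborel f"

text \<open>One factor \<open>1 + \<bar>t\<bar>\<close> pays for a displacement in
  \<open>(c, d)\<close>. A remainder needs two, one for the score increment and one for the
  displacement; the same envelope serves for scores and remainders.\<close>

definition env :: "real \<Rightarrow> real" where "env t = G t * (1 + \<bar>t\<bar>)\<^sup>2"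

text \<open>The second-order Taylor remainder of \<open>l\<close> at \<open>t\<close> for the
  displacement \<open>(d - 1) * t - c\<close>.\<close>

definition rem :: "real \<Rightarrow> real \<Rightarrow> real \<Rightarrow> real" where
  "rem c d t = l (d * t - c) - l t - \<psi> t * ((d - 1) * t - c)"

lemma deriv_l: "(l has_real_derivative \<psi> t) (at t)"
  using differentiable field_differentiable_derivI by blast

lemma env_nonneg: "0 \<le> env t"
  using G_pos[of t] by (simp add: env_def)

lemma residual_lipschitz:
  assumes "max \<bar>c\<bar> \<bar>d - 1\<bar> \<le> s" "max \<bar>c'\<bar> \<bar>d' - 1\<bar> \<le> s" "s \<le> m0"
  shows "\<bar>\<psi> (d * t - c) - \<psi> (d' * t - c')\<bar> \<le> env t * max \<bar>c - c'\<bar> \<bar>d - d'\<bar>"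
proof -
  have u: "\<bar>(d - 1) * t - c\<bar> \<le> (1 + \<bar>t\<bar>) * m0" if "max \<bar>c\<bar> \<bar>d - 1\<bar> \<le> s" for c d
  proof -
    have "\<bar>(d - 1) * t - c\<bar> \<le> \<bar>d - 1\<bar> * \<bar>t\<bar> + \<bar>c\<bar>"
      using abs_triangle_ineq4[of "(d - 1) * t" c] by (simp only: abs_mult)
    also have "\<dots> \<le> m0 * \<bar>t\<bar> + m0" using that assms(3) by (intro add_mono mult_right_mono) auto
    finally show ?thesis by (simp add: algebra_simps)
  qed
  define e where "e = max \<bar>c - c'\<bar> \<bar>d - d'\<bar>"
  have diff: "\<bar>((d - 1) * t - c) - ((d' - 1) * t - c')\<bar> \<le> (1 + \<bar>t\<bar>) * e"
  proof -
    have "((d - 1) * t - c) - ((d' - 1) * t - c') = (d - d') * t - (c - c')"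
      by (simp add: algebra_simps)
    also have "\<bar>\<dots>\<bar> \<le> \<bar>d - d'\<bar> * \<bar>t\<bar> + \<bar>c - c'\<bar>"
      using abs_triangle_ineq4[of "(d - d') * t" "c - c'"] by (simp only: abs_mult)
    also have "\<dots> \<le> e * \<bar>t\<bar> + e" unfolding e_def by (intro add_mono mult_right_mono) auto
    finally show ?thesis by (simp add: algebra_simps)
  qed
  have "\<bar>\<psi> (t + ((d - 1) * t - c)) - \<psi> (t + ((d' - 1) * t - c'))\<bar>
      \<le> G t * \<bar>((d - 1) * t - c) - ((d' - 1) * t - c')\<bar>"
    using u[OF assms(1)] u[OF assms(2)] by (intro lipschitz) simp
  also have "\<dots> \<le> G t * ((1 + \<bar>t\<bar>) * e)"
    using diff G_pos[of t] by (intro mult_left_mono) auto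
  also have "\<dots> \<le> G t * ((1 + \<bar>t\<bar>)\<^sup>2 * e)"
    using G_pos[of t] by (intro mult_left_mono mult_right_mono)
      (auto simp: e_def power2_eq_square algebra_simps)
  finally show ?thesis by (simp add: env_def e_def algebra_simps)
qed

lemma score_lipschitz:
  assumes "max \<bar>c\<bar> \<bar>d - 1\<bar> \<le> s" "s \<le> m0"
  shows "\<bar>\<psi> (d * t - c) - \<psi> t\<bar> \<le> env t * s"
proof -
  have "\<bar>\<psi> (d * t - c) - \<psi> t\<bar> \<le> env t * max \<bar>c\<bar> \<bar>d - 1\<bar>"
    using residual_lipschitz[OF assms(1) _ assms(2), of 0 1 t] assms(1) by auto
  also have "\<dots> \<le> env t * s" using assms(1) env_nonneg by (intro mult_left_mono) auto
  finally show ?thesis .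
qed

text \<open>By the mean value theorem on the segment from \<open>(c', d')\<close> to
  \<open>(c, d)\<close>, the difference is a score increment times a displacement. The increment is
  itself of order \<open>s\<close>, so the Lipschitz constant shrinks with the box; this makes the
  rounding error small relative to the quadratic growth \<open>r^2\<close>.\<close>

lemma rem_lipschitz:
  assumes "max \<bar>c\<bar> \<bar>d - 1\<bar> \<le> s" "max \<bar>c'\<bar> \<bar>d' - 1\<bar> \<le> s" "s \<le> m0"
  shows "\<bar>rem c d t - rem c' d' t\<bar> \<le> env t * (s * max \<bar>c - c'\<bar> \<bar>d - d'\<bar>)"
proof -
  define e where "e = max \<bar>c - c'\<bar> \<bar>d - d'\<bar>"
  define v where "v = (d - d') * t - (c - c')"
  define w where "w \<theta> = (d' + \<theta> * (d - d')) * t - (c' + \<theta> * (c - c'))" for \<theta>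
  \<comment> \<open>The term linear in \<open>\<theta>\<close> is subtracted so that the derivative
    of \<open>h\<close> contains the score increment against \<open>\<psi> t\<close>, not the score
    itself.\<close>
  define h where "h \<theta> = l (w \<theta>) - \<theta> * (\<psi> t * v)" for \<theta>
  have dh: "(h has_real_derivative (\<psi> (w \<theta>) - \<psi> t) * v) (at \<theta>)" for \<theta>
  proof -
    have "((\<lambda>\<theta>. l (w \<theta>)) has_real_derivative \<psi> (w \<theta>) * v) (at \<theta>)"
      by (rule DERIV_chain2[OF deriv_l])
        (auto simp: w_def[abs_def] v_def intro!: derivative_eq_intros)
    then show ?thesis unfolding h_def
      by (auto intro!: derivative_eq_intros simp: algebra_simps)
  qed
  obtain \<theta> where \<theta>: "0 < \<theta>" "\<theta> < 1" "h 1 - h 0 = (1 - 0) * ((\<psi> (w \<theta>) - \<psi> t) * v)"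
    using MVT2[of 0 1 h "\<lambda>\<theta>. (\<psi> (w \<theta>) - \<psi> t) * v"] dh by auto
  have cvx: "\<bar>p' + \<theta> * (p - p')\<bar> \<le> s" if "\<bar>p\<bar> \<le> s" "\<bar>p'\<bar> \<le> s" for p p' :: real
  proof -
    have "\<bar>p' + \<theta> * (p - p')\<bar> = \<bar>(1 - \<theta>) * p' + \<theta> * p\<bar>" by (simp add: algebra_simps)
    also have "\<dots> \<le> (1 - \<theta>) * \<bar>p'\<bar> + \<theta> * \<bar>p\<bar>"
      using \<theta> by (intro order_trans[OF abs_triangle_ineq]) (simp add: abs_mult)
    also have "\<dots> \<le> (1 - \<theta>) * s + \<theta> * s" using \<theta> that by (intro add_mono mult_left_mono) auto
    finally show ?thesis by (simp add: algebra_simps)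
  qed
  have "\<bar>(d' + \<theta> * (d - d')) - 1\<bar> \<le> s"
    using cvx[of "d - 1" "d' - 1"] assms by (simp add: algebra_simps)
  moreover have "\<bar>c' + \<theta> * (c - c')\<bar> \<le> s" using cvx[of c c'] assms by simp
  ultimately have sc: "\<bar>\<psi> (w \<theta>) - \<psi> t\<bar> \<le> G t * (s * (1 + \<bar>t\<bar>))"
  proof -
    let ?d = "d' + \<theta> * (d - d')" and ?c = "c' + \<theta> * (c - c')"
    assume *: "\<bar>?d - 1\<bar> \<le> s" "\<bar>?c\<bar> \<le> s"
    have "\<bar>(?d - 1) * t - ?c\<bar> \<le> \<bar>?d - 1\<bar> * \<bar>t\<bar> + \<bar>?c\<bar>"
      using abs_triangle_ineq4[of "(?d - 1) * t" ?c] by (simp only: abs_mult)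
    also have "\<dots> \<le> s * \<bar>t\<bar> + s" using * by (intro add_mono mult_right_mono) auto
    finally have u: "\<bar>(?d - 1) * t - ?c\<bar> \<le> s * (1 + \<bar>t\<bar>)" by (simp add: algebra_simps)
    also have "s * (1 + \<bar>t\<bar>) \<le> (1 + \<bar>t\<bar>) * m0" using mult_right_mono[OF assms(3), of "1 + \<bar>t\<bar>"] by (simp add: mult.commute)
    finally have "\<bar>\<psi> (t + ((?d - 1) * t - ?c)) - \<psi> (t + 0)\<bar> \<le> G t * \<bar>((?d - 1) * t - ?c) - 0\<bar>"
      using m0 by (intro lipschitz) auto
    also have "\<dots> \<le> G t * (s * (1 + \<bar>t\<bar>))" using u G_pos[of t] by (intro mult_left_mono) auto
    finally show ?thesis by (simp add: w_def algebra_simps)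
  qed
  have "\<bar>v\<bar> \<le> \<bar>d - d'\<bar> * \<bar>t\<bar> + \<bar>c - c'\<bar>"
    unfolding v_def using abs_triangle_ineq4[of "(d - d') * t" "c - c'"] by (simp only: abs_mult)
  also have "\<dots> \<le> e * \<bar>t\<bar> + e" unfolding e_def by (intro add_mono mult_right_mono) auto
  finally have v: "\<bar>v\<bar> \<le> e * (1 + \<bar>t\<bar>)" by (simp add: algebra_simps)
  have s: "0 \<le> s" using assms(1) by auto
  have "rem c d t - rem c' d' t = h 1 - h 0"
    by (simp add: rem_def h_def w_def v_def algebra_simps)
  also have "\<bar>h 1 - h 0\<bar> = \<bar>\<psi> (w \<theta>) - \<psi> t\<bar> * \<bar>v\<bar>" using \<theta>(3) by (simp add: abs_mult)
  also have "\<dots> \<le> G t * (s * (1 + \<bar>t\<bar>)) * (e * (1 + \<bar>t\<bar>))"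
    using sc v G_pos[of t] s by (intro mult_mono) auto
  finally show ?thesis by (simp add: env_def e_def power2_eq_square mult_ac)
qed

lemma rem_0_1 [simp]: "rem 0 1 t = 0"
  by (simp add: rem_def)

lemma rem_bound:
  assumes "max \<bar>c\<bar> \<bar>d - 1\<bar> \<le> s" "s \<le> m0"
  shows "\<bar>rem c d t\<bar> \<le> env t * s\<^sup>2"
proof -
  have s: "0 \<le> s" using assms(1) by auto
  have "\<bar>rem c d t\<bar> \<le> env t * (s * max \<bar>c\<bar> \<bar>d - 1\<bar>)"
    using rem_lipschitz[OF assms(1) _ assms(2), of 0 1 t] s by auto
  also have "\<dots> \<le> env t * (s * s)" using assms(1) env_nonneg s by (intro mult_left_mono) auto
  finally show ?thesis by (simp add: power2_eq_square)
qed

section \<open>Measurability, moments and Gibbs' inequality for the noise law\<close>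

sublocale \<mu>: prob_space \<mu> by (rule prob)

lemma continuous_psi: "continuous_on UNIV \<psi>"
proof (intro continuous_at_imp_continuous_on ballI)
  fix t
  have "((\<lambda>u. \<psi> (t + u) - \<psi> t) \<longlongrightarrow> 0) (at 0)"
  proof (rule Lim_null_comparison)
    have "\<forall>\<^sub>F u in at 0. \<bar>u\<bar> < m0"
      using m0 by (auto simp: eventually_at dist_norm)
    then show "\<forall>\<^sub>F u in at 0. norm (\<psi> (t + u) - \<psi> t) \<le> G t * \<bar>u\<bar>"
    proof (rule eventually_mono)
      fix u :: real assume u: "\<bar>u\<bar> < m0"
      have "1 * m0 \<le> (1 + \<bar>t\<bar>) * m0" using m0 by (intro mult_right_mono) auto
      then have "\<bar>u\<bar> \<le> (1 + \<bar>t\<bar>) * m0" using u by linarith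
      then show "norm (\<psi> (t + u) - \<psi> t) \<le> G t * \<bar>u\<bar>"
        using lipschitz[of u 0 t] m0 by auto
    qed
    show "((\<lambda>u. G t * \<bar>u\<bar>) \<longlongrightarrow> 0) (at 0)" by (auto intro!: tendsto_eq_intros)
  qed
  then have "((\<lambda>u. \<psi> (t + u)) \<longlongrightarrow> \<psi> t) (at 0)" by (rule LIM_zero_cancel)
  then show "isCont \<psi> t" by (simp add: isCont_iff)
qed

lemma psi_measurable [measurable]: "\<psi> \<in> borel_measurable borel"
  using continuous_psi by (rule borel_measurable_continuous_onI)

lemma l_measurable [measurable]: "l \<in> borel_measurable borel"
  unfolding neg_log_def[abs_def] by measurable

lemma rem_measurable [measurable]: "rem c d \<in> borel_measurable borel"
  unfolding rem_def[abs_def] by measurable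

text \<open>Integrability of the square makes \<open>(G t)^2\<close> measurable, and
  \<open>G\<close> is its root by positivity.\<close>

lemma G_measurable [measurable]: "G \<in> borel_measurable borel"
proof -
  have "(\<lambda>t. (G t)\<^sup>2) \<in> borel_measurable borel"
    using borel_measurable_integrable[OF moment_G] by simp
  then have "(\<lambda>t. sqrt ((G t)\<^sup>2)) \<in> borel_measurable borel" by measurable
  then show ?thesis using G_pos by (simp add: real_sqrt_abs abs_of_pos)
qed

lemma env_measurable [measurable]: "env \<in> borel_measurable borel"
  unfolding env_def[abs_def] by measurable

text \<open>The moments of \<open>G^2\<close> and \<open>G^2 * t^4\<close> suffice since
  \<open>(1 + \<bar>t\<bar>)^4 <= 8 * (1 + t^4)\<close>, by applying
  \<open>(1 + a)^2 <= 2 * (1 + a^2)\<close> twice.\<close>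

lemma integrable_env_sq: "integrable \<mu> (\<lambda>t. (env t)\<^sup>2)"
proof (rule Bochner_Integration.integrable_bound)
  show "integrable \<mu> (\<lambda>t. 8 * ((G t)\<^sup>2 + (G t)\<^sup>2 * t ^ 4))"
    using moment_G moment_G_id by auto
  have sq: "(1 + a)\<^sup>2 \<le> 2 * (1 + a\<^sup>2)" for a :: real
    using zero_le_power2[of "1 - a"] by (simp add: power2_eq_square algebra_simps)
  have quartic: "((1 + \<bar>t\<bar>)\<^sup>2)\<^sup>2 \<le> 8 * (1 + t ^ 4)" for t :: real
  proof -
    have "((1 + \<bar>t\<bar>)\<^sup>2)\<^sup>2 \<le> (2 * (1 + t\<^sup>2))\<^sup>2"
      using sq[of "\<bar>t\<bar>"] by (intro power_mono) auto
    also have "\<dots> = 4 * (1 + t\<^sup>2)\<^sup>2" by (simp only: power_mult_distrib) simp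
    also have "\<dots> \<le> 4 * (2 * (1 + (t\<^sup>2)\<^sup>2))" using sq[of "t\<^sup>2"] by (intro mult_left_mono) auto
    finally show ?thesis by simp
  qed
  have "(env t)\<^sup>2 \<le> 8 * ((G t)\<^sup>2 + (G t)\<^sup>2 * t ^ 4)" for t
  proof -
    have "(env t)\<^sup>2 = (G t)\<^sup>2 * ((1 + \<bar>t\<bar>)\<^sup>2)\<^sup>2" unfolding env_def by (rule power_mult_distrib)
    also have "\<dots> \<le> (G t)\<^sup>2 * (8 * (1 + t ^ 4))" using quartic by (intro mult_left_mono) auto
    finally show ?thesis by (simp add: distrib_left)
  qed
  moreover have "0 \<le> 8 * ((G t)\<^sup>2 + (G t)\<^sup>2 * t ^ 4)" for t by simp
  ultimately show "AE t in \<mu>. norm ((env t)\<^sup>2) \<le> norm (8 * ((G t)\<^sup>2 + (G t)\<^sup>2 * t ^ 4))"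
    by (intro AE_I2) (simp only: real_norm_def abs_of_nonneg zero_le_power2)
qed auto

lemma integrable_from_sq:
  fixes h :: "real \<Rightarrow> real"
  assumes [measurable]: "h \<in> borel_measurable borel" and "integrable \<mu> (\<lambda>t. (h t)\<^sup>2)"
  shows "integrable \<mu> h"
  by (rule \<mu>.square_integrable_imp_integrable) (use assms in auto)

lemma integrable_env: "integrable \<mu> env"
  by (rule integrable_from_sq[OF _ integrable_env_sq]) simp

lemma integrable_psi: "integrable \<mu> \<psi>" and integrable_psi_id: "integrable \<mu> (\<lambda>t. \<psi> t * t)"
  by (rule integrable_from_sq[OF _ moment_dl], simp, rule integrable_from_sq[OF _ moment_dl_id], simp)

lemma integrable_rem:
  assumes "max \<bar>c\<bar> \<bar>d - 1\<bar> \<le> m0"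
  shows "integrable \<mu> (rem c d)"
proof (rule Bochner_Integration.integrable_bound[of _ "\<lambda>t. env t * m0\<^sup>2"])
  show "integrable \<mu> (\<lambda>t. env t * m0\<^sup>2)" using integrable_env by auto
  show "AE t in \<mu>. norm (rem c d t) \<le> norm (env t * m0\<^sup>2)"
    using rem_bound[OF assms] env_nonneg by auto
qed auto

lemma expectation_rem_bound:
  assumes "max \<bar>c\<bar> \<bar>d - 1\<bar> \<le> s" "s \<le> m0"
  shows "\<bar>\<integral>t. rem c d t \<partial>\<mu>\<bar> \<le> (\<integral>t. env t \<partial>\<mu>) * s\<^sup>2"
proof -
  have int: "integrable \<mu> (rem c d)" using assms by (intro integrable_rem) auto
  have "\<bar>\<integral>t. rem c d t \<partial>\<mu>\<bar> \<le> (\<integral>t. \<bar>rem c d t\<bar> \<partial>\<mu>)" by (rule integral_abs_bound)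
  also have "\<dots> \<le> (\<integral>t. env t * s\<^sup>2 \<partial>\<mu>)"
    using int integrable_env rem_bound[OF assms] by (intro integral_mono) auto
  finally show ?thesis by simp
qed

lemma expectation_l:
  assumes "max \<bar>c\<bar> \<bar>d - 1\<bar> \<le> m0"
  shows "integrable \<mu> (\<lambda>t. l (d * t - c))"
    and "(\<integral>t. l (d * t - c) \<partial>\<mu>) = (\<integral>t. l t \<partial>\<mu>) + (d - 1) * (\<integral>t. \<psi> t * t \<partial>\<mu>)
      - c * (\<integral>t. \<psi> t \<partial>\<mu>) + (\<integral>t. rem c d t \<partial>\<mu>)"
proof -
  have eq: "(\<lambda>t. l (d * t - c)) = (\<lambda>t. l t + (d - 1) * (\<psi> t * t) - c * \<psi> t + rem c d t)"
    by (auto simp: rem_def algebra_simps)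
  note [simp] = integrable_rem[OF assms] integrable_psi integrable_psi_id moment_l
  show "integrable \<mu> (\<lambda>t. l (d * t - c))" unfolding eq by auto
  show "(\<integral>t. l (d * t - c) \<partial>\<mu>) = (\<integral>t. l t \<partial>\<mu>) + (d - 1) * (\<integral>t. \<psi> t * t \<partial>\<mu>)
      - c * (\<integral>t. \<psi> t \<partial>\<mu>) + (\<integral>t. rem c d t \<partial>\<mu>)" unfolding eq by simp
qed

text \<open>Nonnegativity of the relative entropy between \<open>f\<close> and the density of
  \<open>(xi + c) / d\<close>. The box condition provides the integrability of the shifted
  loss.\<close>

lemma gibbs:
  assumes "max \<bar>c\<bar> \<bar>d - 1\<bar> \<le> m0"
  shows "(\<integral>t. l t \<partial>\<mu>) \<le> (\<integral>t. l (d * t - c) \<partial>\<mu>) - ln d"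
proof -
  have d: "d > 0" using assms m0 by auto
  \<comment> \<open>The likelihood ratio: \<open>d * f (d * t - c)\<close> is again a probability
    density, so \<open>q\<close> has mean 1 under \<open>\<mu>\<close>, and
    \<open>ln q <= q - 1\<close> integrates to the claim.\<close>
  define q where "q t = d * f (d * t - c) / f t" for t
  have [measurable]: "q \<in> borel_measurable borel" unfolding q_def[abs_def] by measurable
  have q_pos: "q t > 0" for t using d f_pos by (simp add: q_def)
  have [simp]: "measure \<mu> UNIV = 1" using \<mu>.prob_space by simp
  have f_nonneg: "0 \<le> f t" and q_nonneg: "0 \<le> q t" for t
    using f_pos q_pos by (simp_all add: less_imp_le)
  have weight: "ennreal (f t) * ennreal (q t) = ennreal d * ennreal (f (- c + d * t))" for t
  proof -
    have "f t * q t = d * f (- c + d * t)" using f_pos[of t] by (simp add: q_def)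
    then have "ennreal (f t * q t) = ennreal (d * f (- c + d * t))" by simp
    then show ?thesis using f_nonneg q_nonneg d by (simp add: ennreal_mult)
  qed
  have "(\<integral>\<^sup>+t. q t \<partial>\<mu>) = (\<integral>\<^sup>+t. ennreal (f t) * ennreal (q t) \<partial>lborel)"
    by (rule nn_integral_density) simp_all
  also have "\<dots> = ennreal d * (\<integral>\<^sup>+t. ennreal (f (- c + d * t)) \<partial>lborel)"
    by (simp add: weight nn_integral_cmult)
  also have "\<dots> = (\<integral>\<^sup>+t. f t \<partial>lborel)"
    using nn_integral_real_affine[of "\<lambda>t. ennreal (f t)" d "- c"] d by simp
  also have "\<dots> = 1"
    using \<mu>.emeasure_space_1 by (simp add: emeasure_density)
  finally have nn: "(\<integral>\<^sup>+t. q t \<partial>\<mu>) = 1" .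
  have int: "integrable \<mu> q"
    by (rule integrableI_nonneg) (simp_all add: nn q_nonneg)
  have "(\<integral>t. q t \<partial>\<mu>) = 1"
    by (subst integral_eq_nn_integral) (simp_all add: nn q_nonneg)
  moreover have "(\<integral>t. ln d - l (d * t - c) + l t \<partial>\<mu>) \<le> (\<integral>t. q t - 1 \<partial>\<mu>)"
  proof (rule integral_mono)
    show "integrable \<mu> (\<lambda>t. ln d - l (d * t - c) + l t)"
      using expectation_l(1)[OF assms] moment_l by auto
    show "integrable \<mu> (\<lambda>t. q t - 1)" using int by auto
    fix t
    have "ln (q t) = ln d - l (d * t - c) + l t"
      using d f_pos[of t] f_pos[of "d * t - c"] by (simp add: q_def neg_log_def ln_div ln_mult)
    then show "ln d - l (d * t - c) + l t \<le> q t - 1"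
      using ln_le_minus_one[OF q_pos[of t]] by simp
  qed
  moreover have "(\<integral>t. ln d - l (d * t - c) + l t \<partial>\<mu>) = ln d - (\<integral>t. l (d * t - c) \<partial>\<mu>) + (\<integral>t. l t \<partial>\<mu>)"
    using expectation_l(1)[OF assms] moment_l by simp
  ultimately show ?thesis using int by simp
qed

text \<open>By Gibbs' inequality (0, 1) minimises the expected loss minus \<open>ln d\<close>.
  Moving one coordinate at a time, with the remainder bounded quadratically, leaves a linear term
  whose coefficient must vanish; in the scale direction \<open>- ln d\<close> supplies the
  1.\<close>

lemma score_mean:
  shows "(\<integral>t. \<psi> t \<partial>\<mu>) = 0" and "(\<integral>t. \<psi> t * t \<partial>\<mu>) = 1"
proof -
  define C where "C = (\<integral>t. env t \<partial>\<mu>)"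
  have "0 \<le> s * (- (\<integral>t. \<psi> t \<partial>\<mu>)) + C * s\<^sup>2" if "\<bar>s\<bar> < m0" for s
  proof -
    have m: "max \<bar>s\<bar> \<bar>1 - 1\<bar> \<le> m0" "max \<bar>s\<bar> \<bar>1 - 1\<bar> \<le> \<bar>s\<bar>" using that m0 by auto
    show ?thesis using gibbs[OF m(1)] expectation_l(2)[OF m(1)] expectation_rem_bound[OF m(2)] that
      by (simp add: C_def)
  qed
  from linear_coeff_zero[OF m0(1) this] show "(\<integral>t. \<psi> t \<partial>\<mu>) = 0" by simp
  have "0 \<le> s * ((\<integral>t. \<psi> t * t \<partial>\<mu>) - 1) + (C + 2) * s\<^sup>2" if "\<bar>s\<bar> < min m0 (1 / 2)" for s
  proof -
    have m: "max \<bar>0\<bar> \<bar>1 + s - 1\<bar> \<le> m0" "max \<bar>0\<bar> \<bar>1 + s - 1\<bar> \<le> \<bar>s\<bar>" using that m0 by auto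
    \<comment> \<open>Replacing \<open>ln (1 + s)\<close> by this bound accounts for the
      \<open>2\<close> in \<open>C + 2\<close> and for the restriction of \<open>s\<close> to
      modulus below 1/2.\<close>
    have "s - 2 * s\<^sup>2 \<le> ln (1 + s)"
      using abs_ln_one_plus_x_minus_x_bound[of s] that by linarith
    then show ?thesis
      using gibbs[OF m(1)] expectation_l(2)[OF m(1)] expectation_rem_bound[OF m(2)] that
      by (simp add: C_def algebra_simps)
  qed
  from linear_coeff_zero[of "min m0 (1 / 2)", OF _ this] show "(\<integral>t. \<psi> t * t \<partial>\<mu>) = 1" using m0 by simp
qed

text \<open>The mean remainder is \<open>H(c, d) - H(0, 1) - (d - 1)\<close>, whereas the Hessian
  gives growth above the tangent plane of \<open>H\<close>. The two agree once the gradient of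
  \<open>H\<close> at (0, 1) is identified as (0, 1), which follows from the quadratic upper bound
  on the mean remainder along each axis.\<close>

lemma expectation_rem_growth:
  assumes "has_hessian (expected_nll f) A (vector [0, 1])" "positive_definite A"
  obtains \<kappa> \<delta> where "\<kappa> > 0" "\<delta> > 0"
    "\<And>c d. max \<bar>c\<bar> \<bar>d - 1\<bar> < \<delta> \<Longrightarrow> \<kappa> * (max \<bar>c\<bar> \<bar>d - 1\<bar>)\<^sup>2 \<le> (\<integral>t. rem c d t \<partial>\<mu>)"
proof -
  obtain g \<kappa> \<delta> where \<kappa>: "\<kappa> > 0" and \<delta>: "\<delta> > 0" and growth:
    "\<And>h. norm h < \<delta> \<Longrightarrow> \<kappa> * (norm h)\<^sup>2
      \<le> expected_nll f (vector [0, 1] + h) - expected_nll f (vector [0, 1]) - g \<bullet> h"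
    by (rule positive_definite_hessian_growth[OF assms]) (rule that)
  define C where "C = (\<integral>t. env t \<partial>\<mu>)"
  define \<delta>' where "\<delta>' = min (\<delta> / 2) m0"
  have \<delta>': "\<delta>' > 0" using \<delta> m0 by (simp add: \<delta>'_def)
  \<comment> \<open>Here \<open>d\<close> denotes the deviation of the scale from 1. The linear
    terms with the unknown gradient \<open>g\<close> are kept; setting one coordinate to 0 then
    determines \<open>g\<close>.\<close>
  have main: "\<kappa> * (max \<bar>c\<bar> \<bar>d\<bar>)\<^sup>2 \<le> (\<integral>t. rem c (1 + d) t \<partial>\<mu>) + (1 - g $ 2) * d - g $ 1 * c"
    if "max \<bar>c\<bar> \<bar>d\<bar> < \<delta>'" for c d
  proof -
    define h :: "real^2" where "h = vector [c, d]"
    have n2: "(norm h)\<^sup>2 = c\<^sup>2 + d\<^sup>2"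
      unfolding power2_norm_eq_inner by (simp add: h_def inner_vec_def sum_2 power2_eq_square)
    have "norm h \<le> \<bar>c\<bar> + \<bar>d\<bar>"
      using norm_le_l1_cart[of h] by (simp add: h_def sum_2)
    also have "\<dots> < \<delta> / 2 + \<delta> / 2"
      using that max.cobounded1[of "\<bar>c\<bar>" "\<bar>d\<bar>"] max.cobounded2[of "\<bar>d\<bar>" "\<bar>c\<bar>"]
        min.cobounded1[of "\<delta> / 2" m0]
      unfolding \<delta>'_def by linarith
    finally have h: "norm h < \<delta>" by simp
    have "(max \<bar>c\<bar> \<bar>d\<bar>)\<^sup>2 \<le> c\<^sup>2 + d\<^sup>2" by (simp add: max_def)
    then have "\<kappa> * (max \<bar>c\<bar> \<bar>d\<bar>)\<^sup>2 \<le> \<kappa> * (norm h)\<^sup>2"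
      unfolding n2 using \<kappa> by (intro mult_left_mono) simp_all
    also have "\<dots> \<le> expected_nll f (vector [0, 1] + h) - expected_nll f (vector [0, 1]) - g \<bullet> h"
      by (rule growth[OF h])
    finally have lower: "\<kappa> * (max \<bar>c\<bar> \<bar>d\<bar>)\<^sup>2
      \<le> expected_nll f (vector [0, 1] + h) - expected_nll f (vector [0, 1]) - g \<bullet> h" .
    have "expected_nll f (vector [0, 1] + h) = (\<integral>t. l ((1 + d) * t - c) \<partial>\<mu>)"
      unfolding expected_nll_def h_def by simp
    moreover have "(\<integral>t. l ((1 + d) * t - c) \<partial>\<mu>) = (\<integral>t. l t \<partial>\<mu>) + d + (\<integral>t. rem c (1 + d) t \<partial>\<mu>)"
      using expectation_l(2)[of c "1 + d"] that by (simp add: \<delta>'_def score_mean)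
    moreover have "expected_nll f (vector [0, 1]) = (\<integral>t. l t \<partial>\<mu>)"
      unfolding expected_nll_def by simp
    moreover have "g \<bullet> h = g $ 1 * c + g $ 2 * d" by (simp add: h_def inner_vec_def sum_2)
    ultimately show ?thesis using lower by (simp add: algebra_simps)
  qed
  have rem_le: "(\<integral>t. rem c (1 + d) t \<partial>\<mu>) \<le> C * s\<^sup>2" if "max \<bar>c\<bar> \<bar>d\<bar> \<le> s" "s < \<delta>'" for c d s
    using expectation_rem_bound[of c "1 + d" s] that by (simp add: C_def \<delta>'_def)
  have "0 \<le> s * (- g $ 1) + C * s\<^sup>2" if "\<bar>s\<bar> < \<delta>'" for s
  proof -
    have "0 \<le> \<kappa> * (max \<bar>s\<bar> \<bar>0\<bar>)\<^sup>2" using \<kappa> by simp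
    then show ?thesis using main[of s 0] rem_le[of s 0 "\<bar>s\<bar>"] that by (simp add: mult.commute)
  qed
  from linear_coeff_zero[OF \<delta>' this] have g1: "g $ 1 = 0" by simp
  have "0 \<le> s * (1 - g $ 2) + C * s\<^sup>2" if "\<bar>s\<bar> < \<delta>'" for s
  proof -
    have "0 \<le> \<kappa> * (max \<bar>0\<bar> \<bar>s\<bar>)\<^sup>2" using \<kappa> by simp
    then show ?thesis using main[of 0 s] rem_le[of 0 s "\<bar>s\<bar>"] that by (simp add: mult.commute)
  qed
  from linear_coeff_zero[OF \<delta>' this] have g2: "g $ 2 = 1" by simp
  show ?thesis
  proof (rule that[OF \<kappa> \<delta>'])
    fix c d assume "max \<bar>c\<bar> \<bar>d - 1\<bar> < \<delta>'"
    then show "\<kappa> * (max \<bar>c\<bar> \<bar>d - 1\<bar>)\<^sup>2 \<le> (\<integral>t. rem c d t \<partial>\<mu>)"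
      using main[of c "d - 1"] g1 g2 by simp
  qed
qed

end

section \<open>Deviation inequalities for independent samples\<close>

lemma exp_le_quadratic:
  fixes u :: real
  assumes "\<bar>u\<bar> \<le> 1"
  shows "exp u \<le> 1 + u + u\<^sup>2"
proof (cases "u \<ge> 0")
  case True
  then show ?thesis using exp_bound[of u] assms by simp
next
  case False
  define v where "v = - u"
  have v: "v > 0" using False by (simp add: v_def)
  have "exp u = 1 / exp v" by (simp add: v_def exp_minus field_simps)
  also have "\<dots> \<le> 1 / (1 + v)" using v by (intro divide_left_mono) auto
  also have "\<dots> \<le> 1 - v + v\<^sup>2"
  proof -
    have "(1 - v + v\<^sup>2) * (1 + v) = 1 + v ^ 3"
      by (simp add: power2_eq_square power3_eq_cube algebra_simps)
    then show ?thesis using v by (simp add: divide_le_eq)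
  qed
  finally show ?thesis by (simp add: v_def)
qed

locale iid_sample = prob_space M for M :: "'a measure" +
  fixes \<xi> :: "nat \<Rightarrow> 'a \<Rightarrow> real" and \<nu> :: "real measure"
  assumes indep: "indep_vars (\<lambda>_. borel) \<xi> UNIV"
    and distr_xi: "\<And>i. distr M borel (\<xi> i) = \<nu>"
begin

lemma xi_measurable [measurable]: "\<xi> i \<in> borel_measurable M"
  using indep by (auto simp: indep_vars_def)

lemma sets_nu [simp, measurable_cong]: "sets \<nu> = sets borel"
  using distr_xi[of 0] by auto

lemma integral_xi:
  fixes h :: "real \<Rightarrow> real"
  assumes [measurable]: "h \<in> borel_measurable borel"
  shows "expectation (\<lambda>\<omega>. h (\<xi> i \<omega>)) = (\<integral>t. h t \<partial>\<nu>)"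
  unfolding distr_xi[of i, symmetric] by (subst integral_distr) auto

lemma integrable_xi:
  fixes h :: "real \<Rightarrow> real"
  assumes [measurable]: "h \<in> borel_measurable borel" and "integrable \<nu> h"
  shows "integrable M (\<lambda>\<omega>. h (\<xi> i \<omega>))"
  using assms(2) unfolding distr_xi[of i, symmetric] by (subst (asm) integrable_distr_eq) auto

lemma prob_space_nu: "prob_space \<nu>"
  unfolding distr_xi[of 0, symmetric] by (rule prob_space_distr) simp

lemma indep_comp:
  fixes h :: "nat \<Rightarrow> real \<Rightarrow> real"
  assumes "\<And>i. h i \<in> borel_measurable borel"
  shows "indep_vars (\<lambda>_. borel) (\<lambda>i \<omega>. h i (\<xi> i \<omega>)) I"
  by (rule indep_vars_compose2[OF indep_vars_subset[OF indep]]) (use assms in auto)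

lemma mean_tail_markov:
  fixes h :: "real \<Rightarrow> real"
  assumes h[measurable]: "h \<in> borel_measurable borel" and int: "integrable \<nu> h"
    and nonneg: "\<And>t. 0 \<le> h t" and n: "n \<ge> 1" and b: "b > 0"
  shows "prob {\<omega> \<in> space M. b \<le> (\<Sum>i<n. h (\<xi> i \<omega>)) / real n} \<le> (\<integral>t. h t \<partial>\<nu>) / b"
proof -
  note [simp] = integrable_xi[OF h int]
  have "prob {\<omega> \<in> space M. b \<le> (\<Sum>i<n. h (\<xi> i \<omega>)) / real n}
      \<le> expectation (\<lambda>\<omega>. (\<Sum>i<n. h (\<xi> i \<omega>)) / real n) / b"
    using nonneg b by (intro integral_Markov_inequality_measure[where A = "space M"])
      (auto intro!: divide_nonneg_nonneg sum_nonneg)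
  also have "expectation (\<lambda>\<omega>. (\<Sum>i<n. h (\<xi> i \<omega>)) / real n) = (\<integral>t. h t \<partial>\<nu>)"
    using n by (simp add: integral_xi)
  finally show ?thesis .
qed

lemma mean_deviation_chebyshev:
  fixes h :: "real \<Rightarrow> real"
  assumes h[measurable]: "h \<in> borel_measurable borel" and int2: "integrable \<nu> (\<lambda>t. (h t)\<^sup>2)"
    and n: "n \<ge> 1" and \<epsilon>: "\<epsilon> > 0"
  shows "prob {\<omega> \<in> space M. \<epsilon> \<le> \<bar>(\<Sum>i<n. h (\<xi> i \<omega>)) / real n - (\<integral>t. h t \<partial>\<nu>)\<bar>}
    \<le> (\<integral>t. (h t)\<^sup>2 \<partial>\<nu>) / (real n * \<epsilon>\<^sup>2)"
proof -
  interpret \<nu>: prob_space \<nu> by (rule prob_space_nu)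
  have h\<nu>[measurable]: "h \<in> borel_measurable \<nu>" by simp
  have int: "integrable \<nu> h" by (rule \<nu>.square_integrable_imp_integrable[OF h\<nu> int2])
  define m where "m = (\<integral>t. h t \<partial>\<nu>)"
  define X where "X i \<omega> = h (\<xi> i \<omega>) - m" for i \<omega>
  define Y where "Y \<omega> = (\<Sum>i<n. X i \<omega>)" for \<omega>
  have [measurable]: "X i \<in> borel_measurable M" for i unfolding X_def[abs_def] by measurable
  have intX: "integrable M (X i)" for i
    unfolding X_def[abs_def] using integrable_xi[OF h int] by simp
  have EX: "expectation (X i) = 0" for i
    unfolding X_def using integrable_xi[OF h int] integral_xi[OF h] by (simp add: m_def prob_space)
  have sq_eq: "(X i \<omega>)\<^sup>2 = (h (\<xi> i \<omega>))\<^sup>2 - 2 * m * h (\<xi> i \<omega>) + m\<^sup>2" for i \<omega>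
    by (simp add: X_def power2_eq_square algebra_simps)
  have h2: "(\<lambda>t. (h t)\<^sup>2) \<in> borel_measurable borel" by measurable
  have intX2: "integrable M (\<lambda>\<omega>. (X i \<omega>)\<^sup>2)" for i
    unfolding sq_eq using integrable_xi[OF h int] integrable_xi[OF h2 int2] by simp
  have EX2: "expectation (\<lambda>\<omega>. (X i \<omega>)\<^sup>2) \<le> (\<integral>t. (h t)\<^sup>2 \<partial>\<nu>)" for i
  proof -
    have "expectation (\<lambda>\<omega>. (X i \<omega>)\<^sup>2) = (\<integral>t. (h t)\<^sup>2 \<partial>\<nu>) - 2 * m * m + m\<^sup>2"
      unfolding sq_eq using integrable_xi[OF h int] integrable_xi[OF h2 int2] integral_xi[OF h] integral_xi[OF h2]
      by (simp add: m_def prob_space)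
    then show ?thesis using zero_le_power2[of m] by (simp add: power2_eq_square)
  qed
  \<comment> \<open>Pairwise independence is extracted from joint independence as that of
    \<open>X i\<close> and the sum of \<open>X\<close> over the singleton
    \<open>{j}\<close>.\<close>
  have indepX: "indep_var borel (X i) borel (X j)" if "i \<noteq> j" for i j
    using indep_vars_sum[of "{j}" i X] indep_comp[of "\<lambda>_ t. h t - m" "insert i {j}"] that
    by (simp add: X_def[abs_def])
  have cross: "expectation (\<lambda>\<omega>. X i \<omega> * X j \<omega>) = 0" "integrable M (\<lambda>\<omega>. X i \<omega> * X j \<omega>)" if "i \<noteq> j" for i j
    using indep_var_lebesgue_integral[OF indepX[OF that] intX intX]
      indep_var_integrable[OF indepX[OF that] intX intX] EX by auto
  have intXX: "integrable M (\<lambda>\<omega>. X i \<omega> * X j \<omega>)" for i j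
    using cross(2)[of i j] intX2[of i] by (cases "i = j") (auto simp: power2_eq_square)
  have Y2: "(Y \<omega>)\<^sup>2 = (\<Sum>i<n. \<Sum>j<n. X i \<omega> * X j \<omega>)" for \<omega>
    by (simp add: Y_def power2_eq_square sum_product)
  have intY2: "integrable M (\<lambda>\<omega>. (Y \<omega>)\<^sup>2)" unfolding Y2 by (intro Bochner_Integration.integrable_sum intXX)
  have "expectation (\<lambda>\<omega>. (Y \<omega>)\<^sup>2) = (\<Sum>i<n. \<Sum>j<n. expectation (\<lambda>\<omega>. X i \<omega> * X j \<omega>))"
    unfolding Y2 using intXX by simp
  also have "\<dots> = (\<Sum>i<n. \<Sum>j<n. if j = i then expectation (\<lambda>\<omega>. (X i \<omega>)\<^sup>2) else 0)"
    using cross(1) by (intro sum.cong refl) (auto simp: power2_eq_square)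
  also have "\<dots> = (\<Sum>i<n. expectation (\<lambda>\<omega>. (X i \<omega>)\<^sup>2))" by simp
  also have "\<dots> \<le> (\<Sum>i<n. \<integral>t. (h t)\<^sup>2 \<partial>\<nu>)" by (intro sum_mono EX2)
  finally have EY2: "expectation (\<lambda>\<omega>. (Y \<omega>)\<^sup>2) \<le> real n * (\<integral>t. (h t)\<^sup>2 \<partial>\<nu>)" by simp
  have pos: "real n * \<epsilon> > 0" using n \<epsilon> by simp
  have [measurable]: "Y \<in> borel_measurable M" unfolding Y_def[abs_def] by measurable
  have Ydev: "(\<Sum>i<n. h (\<xi> i \<omega>)) / real n - m = Y \<omega> / real n" for \<omega>
    using n by (simp add: Y_def X_def sum_subtractf field_simps)
  have "{\<omega> \<in> space M. \<epsilon> \<le> \<bar>(\<Sum>i<n. h (\<xi> i \<omega>)) / real n - m\<bar>} = {\<omega> \<in> space M. (real n * \<epsilon>)\<^sup>2 \<le> (Y \<omega>)\<^sup>2}"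
  proof -
    have "\<epsilon> \<le> \<bar>Y \<omega> / real n\<bar> \<longleftrightarrow> (real n * \<epsilon>)\<^sup>2 \<le> (Y \<omega>)\<^sup>2" for \<omega>
    proof -
      have "\<epsilon> \<le> \<bar>Y \<omega> / real n\<bar> \<longleftrightarrow> real n * \<epsilon> \<le> \<bar>Y \<omega>\<bar>" using n by (simp add: field_simps)
      also have "\<dots> \<longleftrightarrow> \<bar>real n * \<epsilon>\<bar> \<le> \<bar>Y \<omega>\<bar>" using pos by simp
      also have "\<dots> \<longleftrightarrow> (real n * \<epsilon>)\<^sup>2 \<le> (Y \<omega>)\<^sup>2" by (rule abs_le_square_iff)
      finally show ?thesis .
    qed
    then show ?thesis by (simp only: Ydev)
  qed
  then have "prob {\<omega> \<in> space M. \<epsilon> \<le> \<bar>(\<Sum>i<n. h (\<xi> i \<omega>)) / real n - m\<bar>}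
      \<le> expectation (\<lambda>\<omega>. (Y \<omega>)\<^sup>2) / (real n * \<epsilon>)\<^sup>2"
    using integral_Markov_inequality_measure[OF intY2 sets.top _ zero_less_power[OF pos]] by simp
  also have "\<dots> \<le> real n * (\<integral>t. (h t)\<^sup>2 \<partial>\<nu>) / (real n * \<epsilon>)\<^sup>2"
    by (intro divide_right_mono EY2) simp
  also have "\<dots> = (\<integral>t. (h t)\<^sup>2 \<partial>\<nu>) / (real n * \<epsilon>\<^sup>2)"
    using n by (simp add: power2_eq_square)
  finally show ?thesis by (simp add: m_def)
qed

text \<open>
  Since the weights sum to zero, the first-order terms of the moment generating functions
  cancel in the product, and \<open>h\<close> need not be centred.
\<close>

lemma weighted_sum_chernoff:
  fixes h :: "real \<Rightarrow> real" and w :: "nat \<Rightarrow> real"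
  assumes h[measurable]: "h \<in> borel_measurable borel" and bounded: "\<And>t. \<bar>h t\<bar> \<le> b"
    and w: "\<And>i. i < n \<Longrightarrow> \<bar>w i\<bar> \<le> K" and w0: "(\<Sum>i<n. w i) = 0"
    and s: "s \<ge> 0" "s * K * b \<le> 1" and v: "(\<integral>t. (h t)\<^sup>2 \<partial>\<nu>) \<le> v"
  shows "prob {\<omega> \<in> space M. u \<le> (\<Sum>i<n. w i * h (\<xi> i \<omega>))} \<le> exp (real n * (s\<^sup>2 * K\<^sup>2 * v) - s * u)"
proof -
  interpret \<nu>: prob_space \<nu> by (rule prob_space_nu)
  have b: "b \<ge> 0" using bounded[of 0] by linarith
  define m where "m = (\<integral>t. h t \<partial>\<nu>)"
  have h\<nu>[measurable]: "h \<in> borel_measurable \<nu>" by simp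
  have int: "integrable \<nu> h"
    by (rule \<nu>.integrable_const_bound[of _ b]) (use bounded in auto)
  have "(h t)\<^sup>2 \<le> b\<^sup>2" for t using power_mono[OF bounded[of t], of 2] by simp
  then have int2: "integrable \<nu> (\<lambda>t. (h t)\<^sup>2)"
    by (intro \<nu>.integrable_const_bound[of _ "b\<^sup>2"]) auto
  define Z where "Z i \<omega> = exp (s * w i * h (\<xi> i \<omega>))" for i \<omega>
  have small: "\<bar>s * w i * h t\<bar> \<le> 1" if "i < n" for i t
  proof -
    have "\<bar>s * w i * h t\<bar> = s * \<bar>w i\<bar> * \<bar>h t\<bar>" using s by (simp add: abs_mult)
    also have "\<dots> \<le> s * K * b" using s b w[OF that] bounded[of t] by (intro mult_mono mult_left_mono) auto
    finally show ?thesis using s by simp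
  qed
  have int_exp: "integrable \<nu> (\<lambda>t. exp (s * w i * h t))" if "i < n" for i
  proof (rule \<nu>.integrable_const_bound[of _ "exp 1"])
    show "AE t in \<nu>. norm (exp (s * w i * h t)) \<le> exp 1"
      using small[OF that] by (auto simp: abs_le_iff)
  qed measurable
  have EZ: "expectation (Z i) \<le> exp (s * w i * m + s\<^sup>2 * K\<^sup>2 * v)" if i: "i < n" for i
  proof -
    have "expectation (Z i) = (\<integral>t. exp (s * w i * h t) \<partial>\<nu>)"
      unfolding Z_def by (rule integral_xi) measurable
    also have "\<dots> \<le> (\<integral>t. 1 + s * w i * h t + (s * w i)\<^sup>2 * (h t)\<^sup>2 \<partial>\<nu>)"
    proof (rule integral_mono[OF int_exp[OF i]])
      show "integrable \<nu> (\<lambda>t. 1 + s * w i * h t + (s * w i)\<^sup>2 * (h t)\<^sup>2)" using int int2 by auto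
      show "exp (s * w i * h t) \<le> 1 + s * w i * h t + (s * w i)\<^sup>2 * (h t)\<^sup>2" for t
        using exp_le_quadratic[OF small[OF i]] by (simp add: power_mult_distrib)
    qed
    also have "\<dots> = 1 + s * w i * m + (s * w i)\<^sup>2 * (\<integral>t. (h t)\<^sup>2 \<partial>\<nu>)"
      using int int2 by (simp add: m_def \<nu>.prob_space)
    also have "(s * w i)\<^sup>2 * (\<integral>t. (h t)\<^sup>2 \<partial>\<nu>) \<le> (s\<^sup>2 * K\<^sup>2) * v"
    proof (rule mult_mono)
      have "(w i)\<^sup>2 \<le> K\<^sup>2" using power_mono[OF w[OF i], of 2] by simp
      then show "(s * w i)\<^sup>2 \<le> s\<^sup>2 * K\<^sup>2" by (simp add: power_mult_distrib mult_left_mono)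
    qed (use v in auto)
    also have "1 + s * w i * m + (s\<^sup>2 * K\<^sup>2) * v \<le> exp (s * w i * m + s\<^sup>2 * K\<^sup>2 * v)"
      using exp_ge_add_one_self[of "s * w i * m + s\<^sup>2 * K\<^sup>2 * v"] by (simp add: algebra_simps)
    finally show ?thesis by simp
  qed
  have intZ: "integrable M (Z i)" if "i < n" for i
    unfolding Z_def using int_exp[OF that] by (intro integrable_xi) auto
  have indepZ: "indep_vars (\<lambda>_. borel) Z {..<n}"
    unfolding Z_def[abs_def] by (rule indep_comp) measurable
  define P where "P \<omega> = (\<Prod>i<n. Z i \<omega>)" for \<omega>
  have P: "P \<omega> = exp (s * (\<Sum>i<n. w i * h (\<xi> i \<omega>)))" for \<omega>
    by (simp add: P_def Z_def exp_sum[symmetric] sum_distrib_left mult.assoc)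
  have intP: "integrable M P" unfolding P_def[abs_def]
    by (rule indep_vars_integrable[OF _ indepZ]) (use intZ in auto)
  have "expectation P = (\<Prod>i<n. expectation (Z i))" unfolding P_def[abs_def]
    by (rule indep_vars_lebesgue_integral[OF _ indepZ]) (use intZ in auto)
  also have "\<dots> \<le> (\<Prod>i<n. exp (s * w i * m + s\<^sup>2 * K\<^sup>2 * v))"
    by (intro prod_mono conjI EZ) (auto simp: Z_def[abs_def] intro!: integral_nonneg_AE)
  also have "\<dots> = exp (\<Sum>i<n. s * w i * m + s\<^sup>2 * K\<^sup>2 * v)" by (simp add: exp_sum)
  also have "(\<Sum>i<n. s * w i * m + s\<^sup>2 * K\<^sup>2 * v) = s * m * (\<Sum>i<n. w i) + real n * (s\<^sup>2 * K\<^sup>2 * v)"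
    by (simp add: sum.distrib sum_distrib_left mult_ac)
  finally have EP: "expectation P \<le> exp (real n * (s\<^sup>2 * K\<^sup>2 * v))" using w0 by simp
  have "prob {\<omega> \<in> space M. u \<le> (\<Sum>i<n. w i * h (\<xi> i \<omega>))} \<le> prob {\<omega> \<in> space M. exp (s * u) \<le> P \<omega>}"
  proof (rule finite_measure_mono)
    show "{\<omega> \<in> space M. u \<le> (\<Sum>i<n. w i * h (\<xi> i \<omega>))} \<subseteq> {\<omega> \<in> space M. exp (s * u) \<le> P \<omega>}"
      using s by (auto simp: P intro!: mult_left_mono)
    have [measurable]: "P \<in> borel_measurable M" using intP by simp
    show "{\<omega> \<in> space M. exp (s * u) \<le> P \<omega>} \<in> events" by measurable
  qed
  also have "\<dots> \<le> expectation P / exp (s * u)"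
    by (rule integral_Markov_inequality_measure[OF intP, of "space M"]) (auto simp: P)
  also have "\<dots> \<le> exp (real n * (s\<^sup>2 * K\<^sup>2 * v)) / exp (s * u)" by (intro divide_right_mono EP) simp
  also have "\<dots> = exp (real n * (s\<^sup>2 * K\<^sup>2 * v) - s * u)" by (simp add: exp_diff)
  finally show ?thesis .
qed

end

text \<open>By right continuity of the distribution function the infimum defining the quantile is
  attained; \<open>u\<close> strictly between 0 and 1 makes it an infimum over a nonempty set
  bounded below.\<close>

lemma (in prob_space) prob_le_quantile_fun:
  assumes [measurable]: "X \<in> borel_measurable M" and u: "0 < u" "u < 1"
  shows "u \<le> prob {\<omega> \<in> space M. X \<omega> \<le> quantile_fun (cdf (distr M borel X)) u}"
proof -
  interpret D: real_distribution "distr M borel X" by (rule real_distribution_distr) simp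
  interpret D: cdf_distribution "distr M borel X" by unfold_locales
  define q where "q = quantile_fun (cdf (distr M borel X)) u"
  have "u \<le> cdf (distr M borel X) q"
    using D.pseudoinverse[OF u, of q] by (simp add: q_def quantile_fun_def)
  also have "\<dots> = prob (X -` {..q} \<inter> space M)" by (simp add: cdf_def measure_distr)
  also have "X -` {..q} \<inter> space M = {\<omega> \<in> space M. X \<omega> \<le> q}" by auto
  finally show ?thesis by (simp add: q_def)
qed

section \<open>Selection on a grid\<close>

definition grid_coord :: "real \<Rightarrow> nat \<Rightarrow> int \<Rightarrow> real" where
  "grid_coord r k i = r * real_of_int i / real k"

text \<open>Rounding down is exact at the endpoints, where the rescaled coordinate is the integer
  \<open>k\<close> or \<open>- k\<close>. Boundary points of the box thus round to boundary grid
  points, the only ones where the full growth \<open>\<kappa> * r^2\<close> is available.\<close>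

lemma grid_coord_round:
  assumes r: "r > 0" and k: "k \<ge> 1" and a: "\<bar>a\<bar> \<le> r"
  shows "\<exists>i\<in>{- int k..int k}. \<bar>a - grid_coord r k i\<bar> \<le> r / real k \<and> (\<bar>a\<bar> = r \<longrightarrow> \<bar>i\<bar> = int k)"
proof -
  define b where "b = a * real k / r"
  have k0: "real k > 0" using k by simp
  have ab: "a = r * b / real k" using r k0 by (simp add: b_def)
  have "\<bar>b\<bar> = \<bar>a\<bar> / r * real k" using r by (simp add: b_def abs_mult)
  also have "\<dots> \<le> 1 * real k" using r a by (intro mult_right_mono) auto
  finally have b: "- real k \<le> b" "b \<le> real k" by auto
  have i: "\<lfloor>b\<rfloor> \<in> {- int k..int k}" using b by (auto simp: le_floor_iff floor_le_iff)
  have "\<bar>a - grid_coord r k \<lfloor>b\<rfloor>\<bar> = \<bar>r * (b - \<lfloor>b\<rfloor>) / real k\<bar>"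
    by (simp add: ab grid_coord_def diff_divide_distrib right_diff_distrib)
  also have "\<dots> = r * \<bar>b - \<lfloor>b\<rfloor>\<bar> / real k" using r k0 by (simp add: abs_mult)
  also have "\<dots> \<le> r * 1 / real k"
    using r by (intro divide_right_mono mult_left_mono) linarith+
  finally have close: "\<bar>a - grid_coord r k \<lfloor>b\<rfloor>\<bar> \<le> r / real k" by simp
  have "\<bar>\<lfloor>b\<rfloor>\<bar> = int k" if "\<bar>a\<bar> = r"
  proof (cases "a \<ge> 0")
    case True
    then have "b = real_of_int (int k)" using that r by (auto simp: b_def)
    then show ?thesis by (simp only: floor_of_int)
  next
    case False
    then have "b = real_of_int (- int k)" using that r by (auto simp: b_def abs_if)
    then show ?thesis by (simp only: floor_of_int)
  qed
  with i close show ?thesis by blast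
qed

lemma grid_coord_bound:
  assumes "r > 0" "k \<ge> 1" "i \<in> {- int k..int k}"
  shows "\<bar>grid_coord r k i\<bar> \<le> r"
proof -
  have "\<bar>grid_coord r k i\<bar> = r * \<bar>real_of_int i\<bar> / real k" using assms by (simp add: grid_coord_def abs_mult)
  also have "\<dots> \<le> r * real k / real k"
    using assms by (intro divide_right_mono mult_left_mono) auto
  finally show ?thesis using assms by simp
qed

lemma grid_coord_boundary:
  assumes "r > 0" "k \<ge> 1" "\<bar>i\<bar> = int k"
  shows "\<bar>grid_coord r k i\<bar> = r"
proof -
  have "\<bar>real_of_int i\<bar> = real k" using assms(3) by linarith
  then show ?thesis using assms by (simp add: grid_coord_def abs_mult)
qed

lemma grid_round:
  assumes r: "r > 0" and k: "k \<ge> 1" and "max \<bar>c\<bar> \<bar>d - 1\<bar> \<le> r"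
  obtains i j where "i \<in> {- int k..int k}" "j \<in> {- int k..int k}"
    "max \<bar>c - grid_coord r k i\<bar> \<bar>d - (1 + grid_coord r k j)\<bar> \<le> r / real k"
    "max \<bar>c\<bar> \<bar>d - 1\<bar> = r \<Longrightarrow> max \<bar>i\<bar> \<bar>j\<bar> = int k"
proof -
  obtain i where i: "i \<in> {- int k..int k}" "\<bar>c - grid_coord r k i\<bar> \<le> r / real k" "\<bar>c\<bar> = r \<longrightarrow> \<bar>i\<bar> = int k"
    using grid_coord_round[OF r k, of c] assms(3) by auto
  obtain j where j: "j \<in> {- int k..int k}" "\<bar>d - 1 - grid_coord r k j\<bar> \<le> r / real k"
    "\<bar>d - 1\<bar> = r \<longrightarrow> \<bar>j\<bar> = int k"
    using grid_coord_round[OF r k, of "d - 1"] assms(3) by auto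
  show ?thesis
  proof (rule that[OF i(1) j(1)])
    show "max \<bar>c - grid_coord r k i\<bar> \<bar>d - (1 + grid_coord r k j)\<bar> \<le> r / real k"
      using i(2) j(2) by (simp add: algebra_simps)
    assume "max \<bar>c\<bar> \<bar>d - 1\<bar> = r"
    then have "\<bar>i\<bar> = int k \<or> \<bar>j\<bar> = int k" using i(3) j(3) by (auto simp: max_def split: if_splits)
    moreover have "\<bar>i\<bar> \<le> int k" "\<bar>j\<bar> \<le> int k" using i(1) j(1) by auto
    ultimately show "max \<bar>i\<bar> \<bar>j\<bar> = int k" by linarith
  qed
qed

section \<open>Deterministic selection from finitely many empirical conditions\<close>

context regular_noise
begin

text \<open>Truncation is decided by the envelope, not by the score difference itself, so the
  discarded set is the same for all \<open>(c, d)\<close> and a single tail average bounds the loss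
  at every grid point.\<close>

definition trunc_score :: "real \<Rightarrow> real \<Rightarrow> real \<Rightarrow> real \<Rightarrow> real" where
  "trunc_score \<tau> c d t = (if env t \<le> \<tau> then \<psi> (d * t - c) - \<psi> t else 0)"

definition env_tail :: "real \<Rightarrow> real \<Rightarrow> real" where
  "env_tail \<tau> t = (if env t \<le> \<tau> then 0 else env t)"

text \<open>With \<open>ln d <= d - 1\<close> the risk difference is at least the mean remainder
  plus \<open>(d - 1) * (S1 - 1) - c * S0\<close>. The budget in units of
  \<open>\<kappa> * r^2\<close>: the remainder at the rounded point gives 1/2, the mesh costs
  strictly less than 1/4, and the two score deviations cost 1/8 each.\<close>

lemma profile_risk_boundary:
  assumes n: "n \<ge> 1" and r: "0 < r" "r \<le> m0" and k: "k \<ge> 1"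
    and score0: "\<bar>(\<Sum>i<n. \<psi> (e i)) / real n\<bar> \<le> \<kappa> * r / 8"
    and score1: "\<bar>(\<Sum>i<n. \<psi> (e i) * e i) / real n - 1\<bar> \<le> \<kappa> * r / 8"
    and env: "(\<Sum>i<n. env (e i)) / real n \<le> a"
    and growth: "\<And>i j. i \<in> {- int k..int k} \<Longrightarrow> j \<in> {- int k..int k} \<Longrightarrow> max \<bar>i\<bar> \<bar>j\<bar> = int k \<Longrightarrow>
      \<kappa> * r\<^sup>2 / 2 \<le> (\<Sum>m<n. rem (grid_coord r k i) (1 + grid_coord r k j) (e m)) / real n"
    and mesh: "a < \<kappa> * real k / 4"
    and cd: "max \<bar>c\<bar> \<bar>d - 1\<bar> = r"
  shows "profile_risk l n e 0 1 < profile_risk l n e c d"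
proof -
  have n0: "real n > 0" and k0: "real k > 0" using n k by auto
  obtain i j where ij: "i \<in> {- int k..int k}" "j \<in> {- int k..int k}"
    "max \<bar>c - grid_coord r k i\<bar> \<bar>d - (1 + grid_coord r k j)\<bar> \<le> r / real k"
    "max \<bar>i\<bar> \<bar>j\<bar> = int k"
    by (rule grid_round[OF r(1) k eq_refl[OF cd]]) (use cd in blast)
  define c' d' where "c' = grid_coord r k i" and "d' = 1 + grid_coord r k j"
  have box: "max \<bar>c'\<bar> \<bar>d' - 1\<bar> \<le> r"
    using grid_coord_bound[OF r(1) k] ij by (simp add: c'_def d'_def)
  \<comment> \<open>The rounding loss carries \<open>r * (r / k)\<close>, so a mesh bound on
    \<open>k\<close> independent of \<open>r\<close> keeps it below the growth.\<close>
  have pt: "rem c' d' t - env t * (r * (r / real k)) \<le> rem c d t" for t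
  proof -
    have "\<bar>rem c d t - rem c' d' t\<bar> \<le> env t * (r * max \<bar>c - c'\<bar> \<bar>d - d'\<bar>)"
      by (rule rem_lipschitz) (use box cd r in auto)
    also have "\<dots> \<le> env t * (r * (r / real k))"
      using ij(3) env_nonneg r by (intro mult_left_mono) (auto simp: c'_def d'_def)
    finally show ?thesis by linarith
  qed
  have "(\<Sum>m<n. rem c' d' (e m)) / real n - (\<Sum>m<n. env (e m)) / real n * (r * (r / real k))
      = (\<Sum>m<n. rem c' d' (e m) - env (e m) * (r * (r / real k))) / real n"
    by (simp only: sum_subtractf sum_distrib_right[symmetric] diff_divide_distrib times_divide_eq_left)
  also have "\<dots> \<le> (\<Sum>m<n. rem c d (e m)) / real n"
    using pt by (intro divide_right_mono sum_mono) auto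
  finally have 1: "(\<Sum>m<n. rem c' d' (e m)) / real n - (\<Sum>m<n. env (e m)) / real n * (r * (r / real k))
     \<le> (\<Sum>m<n. rem c d (e m)) / real n" .
  have "(\<Sum>m<n. env (e m)) / real n * (r * (r / real k)) \<le> a * (r * (r / real k))"
    using env r by (intro mult_right_mono) auto
  also have "\<dots> = a * (r\<^sup>2 / real k)" by (simp add: power2_eq_square)
  also have "\<dots> < \<kappa> * real k / 4 * (r\<^sup>2 / real k)"
    using mesh r k0 by (intro mult_strict_right_mono) auto
  also have "\<dots> = \<kappa> * r\<^sup>2 / 4" using k0 by simp
  finally have 2: "(\<Sum>m<n. env (e m)) / real n * (r * (r / real k)) < \<kappa> * r\<^sup>2 / 4" .
  have 3: "\<kappa> * r\<^sup>2 / 2 \<le> (\<Sum>m<n. rem c' d' (e m)) / real n"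
    unfolding c'_def d'_def by (rule growth[OF ij(1,2,4)])
  define S0 where "S0 = (\<Sum>i<n. \<psi> (e i)) / real n"
  define S1 where "S1 = (\<Sum>i<n. \<psi> (e i) * e i) / real n"
  have d: "d > 0" using cd r m0 by linarith
  have "\<bar>d - 1\<bar> \<le> r" "\<bar>c\<bar> \<le> r" using cd by auto
  then have "\<bar>(d - 1) * (S1 - 1)\<bar> \<le> r * (\<kappa> * r / 8)" "\<bar>c * S0\<bar> \<le> r * (\<kappa> * r / 8)"
    using r score0[folded S0_def] score1[folded S1_def]
    unfolding abs_mult by (simp_all only: mult_mono abs_ge_zero less_imp_le)
  moreover have r2: "\<kappa> * r\<^sup>2 / 4 = 2 * (r * (\<kappa> * r / 8))" by (simp add: power2_eq_square)
  ultimately have 4: "(d - 1) * (S1 - 1) - c * S0 \<ge> - (\<kappa> * r\<^sup>2 / 4)"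
    unfolding r2 by linarith
  have "(\<Sum>m<n. l (d * e m - c)) = (\<Sum>m<n. l (e m) + (d - 1) * (\<psi> (e m) * e m) - c * \<psi> (e m) + rem c d (e m))"
    by (intro sum.cong refl) (simp add: rem_def algebra_simps)
  then have "(\<Sum>m<n. l (d * e m - c)) / real n
      = (\<Sum>m<n. l (e m)) / real n + (d - 1) * S1 - c * S0 + (\<Sum>m<n. rem c d (e m)) / real n"
    by (simp add: sum.distrib sum_subtractf sum_distrib_left[symmetric] S0_def S1_def
        add_divide_distrib diff_divide_distrib)
  then have "profile_risk l n e c d - profile_risk l n e 0 1
      = (d - 1) * S1 - c * S0 + (\<Sum>m<n. rem c d (e m)) / real n - ln d"
    by (simp add: profile_risk_def)
  moreover have "ln d \<le> d - 1" by (rule ln_le_minus_one[OF d])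
  ultimately have "profile_risk l n e c d - profile_risk l n e 0 1
      \<ge> (d - 1) * (S1 - 1) - c * S0 + (\<Sum>m<n. rem c d (e m)) / real n"
    by (simp add: algebra_simps)
  with 1 2 3 4 show ?thesis by linarith
qed

text \<open>The three errors are the truncated score at the rounded grid point (\<open>t1\<close>),
  the part removed by truncation (\<open>t2\<close>), and the rounding of \<open>(c, d)\<close>,
  charged to the untruncated envelope average.\<close>

lemma score_process_bound:
  assumes n: "n \<ge> 1" and r: "0 < r" "r \<le> m0" and k: "k \<ge> 1"
    and w: "\<And>i. i < n \<Longrightarrow> \<bar>w i\<bar> \<le> K"
    and env: "(\<Sum>i<n. env (e i)) / real n \<le> a"
    and tail: "K * r * ((\<Sum>i<n. env_tail \<tau> (e i)) / real n) \<le> t2"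
    and grid: "\<And>i j. i \<in> {- int k..int k} \<Longrightarrow> j \<in> {- int k..int k} \<Longrightarrow>
      \<bar>\<Sum>m<n. w m * trunc_score \<tau> (grid_coord r k i) (1 + grid_coord r k j) (e m)\<bar> \<le> real n * t1"
    and cd: "max \<bar>c\<bar> \<bar>d - 1\<bar> \<le> r"
  shows "\<bar>(\<Sum>m<n. (\<psi> (d * e m - c) - \<psi> (e m)) * w m) / real n\<bar> \<le> t1 + t2 + K * a * (r / real k)"
proof -
  have n0: "real n > 0" using n by auto
  have K: "K \<ge> 0" using w[of 0] n by linarith
  obtain i j where ij: "i \<in> {- int k..int k}" "j \<in> {- int k..int k}"
    "max \<bar>c - grid_coord r k i\<bar> \<bar>d - (1 + grid_coord r k j)\<bar> \<le> r / real k"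
    by (rule grid_round[OF r(1) k cd])
  define c' d' where "c' = grid_coord r k i" and "d' = 1 + grid_coord r k j"
  have box: "max \<bar>c'\<bar> \<bar>d' - 1\<bar> \<le> r"
    using grid_coord_bound[OF r(1) k] ij by (simp add: c'_def d'_def)
  define T where "T t = trunc_score \<tau> c' d' t" for t
  have pt: "\<bar>(\<psi> (d * t - c) - \<psi> t) - T t\<bar> \<le> env t * (r / real k) + env_tail \<tau> t * r" for t
  proof -
    have "\<bar>\<psi> (d * t - c) - \<psi> (d' * t - c')\<bar> \<le> env t * max \<bar>c - c'\<bar> \<bar>d - d'\<bar>"
      by (rule residual_lipschitz[OF cd box r(2)])
    also have "\<dots> \<le> env t * (r / real k)"
      using ij(3) env_nonneg by (intro mult_left_mono) (auto simp: c'_def d'_def)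
    finally have "\<bar>\<psi> (d * t - c) - \<psi> (d' * t - c')\<bar> \<le> env t * (r / real k)" .
    moreover have "\<bar>(\<psi> (d' * t - c') - \<psi> t) - T t\<bar> \<le> env_tail \<tau> t * r"
      using score_lipschitz[OF box r(2), of t] by (simp add: T_def trunc_score_def env_tail_def)
    ultimately show ?thesis by linarith
  qed
  have "\<bar>(\<Sum>m<n. (\<psi> (d * e m - c) - \<psi> (e m)) * w m) - (\<Sum>m<n. w m * T (e m))\<bar>
      = \<bar>\<Sum>m<n. ((\<psi> (d * e m - c) - \<psi> (e m)) - T (e m)) * w m\<bar>"
    by (simp add: sum_subtractf[symmetric] algebra_simps)
  also have "\<dots> \<le> (\<Sum>m<n. \<bar>(\<psi> (d * e m - c) - \<psi> (e m)) - T (e m)\<bar> * \<bar>w m\<bar>)"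
    unfolding abs_mult[symmetric] by (rule sum_abs)
  also have "\<dots> \<le> (\<Sum>m<n. (env (e m) * (r / real k) + env_tail \<tau> (e m) * r) * K)"
    by (rule sum_mono, rule mult_mono[OF pt w])
      (use env_nonneg r in \<open>auto simp: env_tail_def intro!: add_nonneg_nonneg mult_nonneg_nonneg\<close>)
  also have "\<dots> = real n * (K * ((\<Sum>m<n. env (e m)) / real n) * (r / real k)
      + K * r * ((\<Sum>m<n. env_tail \<tau> (e m)) / real n))"
  proof -
    define A B where "A = (\<Sum>m<n. env (e m)) / real n" and "B = (\<Sum>m<n. env_tail \<tau> (e m)) / real n"
    have AB: "(\<Sum>m<n. env (e m)) = real n * A" "(\<Sum>m<n. env_tail \<tau> (e m)) = real n * B"
      using n0 by (simp_all add: A_def B_def)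
    have "(\<Sum>m<n. (env (e m) * (r / real k) + env_tail \<tau> (e m) * r) * K)
        = (\<Sum>m<n. env (e m)) * (r / real k) * K + (\<Sum>m<n. env_tail \<tau> (e m)) * r * K"
      by (simp only: sum.distrib sum_distrib_right distrib_right)
    also have "\<dots> = real n * (K * A * (r / real k) + K * r * B)"
      unfolding AB by (simp only: distrib_left mult_ac)
    finally show ?thesis by (simp only: A_def B_def)
  qed
  also have "\<dots> \<le> real n * (K * a * (r / real k) + t2)"
    using env tail K r n0 by (intro mult_left_mono add_mono mult_right_mono) auto
  finally have "\<bar>\<Sum>m<n. (\<psi> (d * e m - c) - \<psi> (e m)) * w m\<bar> \<le> real n * (K * a * (r / real k) + t2) + real n * t1"
    using grid[OF ij(1,2)] unfolding T_def c'_def d'_def by linarith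
  also have "\<dots> = (t1 + t2 + K * a * (r / real k)) * real n" by (simp only: distrib_left distrib_right mult_ac add_ac)
  finally show ?thesis using n0 by (simp only: abs_divide abs_of_pos pos_divide_le_eq)
qed

text \<open>All randomness is moved into inequalities for one noise vector \<open>e\<close>. They
  produce the stationary point and the strict score bound for every penalised column;
  \<open>lam\<close> must cover \<open>lambda_star\<close> and the score error, inflated by
  \<open>1 + r\<close>.\<close>

lemma null_selection_deterministic:
  fixes e y :: "nat \<Rightarrow> real" and x :: "nat \<Rightarrow> nat \<Rightarrow> real"
  assumes n: "n \<ge> 1" and p: "p \<ge> 1" and r: "0 < r" "r \<le> m0" and k: "k \<ge> 1"
    and intercept: "\<And>i. i < n \<Longrightarrow> x i 0 = 1"
    and x_bound: "\<And>i j. i < n \<Longrightarrow> j < p \<Longrightarrow> \<bar>x i j\<bar> \<le> K"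
    and y: "\<And>i. i < n \<Longrightarrow> y i = b0 + e i"
    and score0: "\<bar>(\<Sum>i<n. \<psi> (e i)) / real n\<bar> \<le> \<kappa> * r / 8"
    and score1: "\<bar>(\<Sum>i<n. \<psi> (e i) * e i) / real n - 1\<bar> \<le> \<kappa> * r / 8"
    and env: "(\<Sum>i<n. env (e i)) / real n \<le> a"
    and growth: "\<And>i j. i \<in> {- int k..int k} \<Longrightarrow> j \<in> {- int k..int k} \<Longrightarrow> max \<bar>i\<bar> \<bar>j\<bar> = int k \<Longrightarrow>
      \<kappa> * r\<^sup>2 / 2 \<le> (\<Sum>m<n. rem (grid_coord r k i) (1 + grid_coord r k j) (e m)) / real n"
    and mesh: "a < \<kappa> * real k / 4"
    and risk: "(\<Sum>i<n. l (e i)) / real n \<le> b"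
    and tail: "K * r * ((\<Sum>i<n. env_tail \<tau> (e i)) / real n) \<le> t2"
    and grid: "\<And>h i j. h \<in> {1..<p} \<Longrightarrow> i \<in> {- int k..int k} \<Longrightarrow> j \<in> {- int k..int k} \<Longrightarrow>
      \<bar>\<Sum>m<n. x m h * trunc_score \<tau> (grid_coord r k i) (1 + grid_coord r k j) (e m)\<bar> \<le> real n * t1"
    and star: "lambda_star f n p x e \<le> q"
    and lam: "(1 + r) * (q + exp b * (t1 + t2 + K * a * (r / real k))) < lam"
  shows "\<exists>\<theta>. is_exp_lasso l n p x y lam \<theta>"
    and "is_exp_lasso l n p x y lam (\<beta>, \<sigma>) \<Longrightarrow> j \<in> {1..<p} \<Longrightarrow> \<beta> j = 0"
proof -
  have r1: "r < 1" using r m0 by linarith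
  have boundary: "profile_risk l n e 0 1 < profile_risk l n e c d" if "max \<bar>c\<bar> \<bar>d - 1\<bar> = r" for c d
    by (rule profile_risk_boundary[OF n r k score0 score1 env growth mesh that])
  obtain c d where cd: "\<bar>c\<bar> < r" "\<bar>d - 1\<bar> < r" "profile_risk l n e c d \<le> profile_risk l n e 0 1"
    "(\<Sum>i<n. \<psi> (d * e i - c)) = 0" "(\<Sum>i<n. \<psi> (d * e i - c) * e i) = real n / d"
    by (rule profile_risk_stationary_point[OF deriv_l n r(1) r1 boundary])
  have d: "d > 0" using cd r1 by linarith
  define Q where "Q = (\<Sum>i<n. l (d * e i - c)) / real n"
  define L where "L = (\<Sum>i<n. l (e i)) / real n"
  define t where "t = t1 + t2 + K * a * (r / real k)"
  \<comment> \<open>Minimality compares the exponential factors at once: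
    \<open>exp Q <= d * exp L\<close> with \<open>d < 1 + r\<close>, and \<open>exp L\<close> is
    precisely the exponential factor in \<open>lambda_star\<close>.\<close>
  have "Q - ln d \<le> L" using cd(3) by (simp add: profile_risk_def Q_def L_def)
  then have "exp Q \<le> exp (L + ln d)" by simp
  also have "\<dots> = d * exp L" using d by (simp add: exp_add)
  also have "\<dots> \<le> (1 + r) * exp L" using cd by (intro mult_right_mono) auto
  finally have expQ: "exp Q \<le> (1 + r) * exp L" .
  have small: "exp Q * \<bar>(\<Sum>i<n. \<psi> (d * e i - c) * x i j) / real n\<bar> < lam" if j: "j \<in> {1..<p}" for j
  proof -
    define g0 where "g0 = (\<Sum>i<n. \<psi> (e i) * x i j) / real n"
    have "\<bar>(\<Sum>m<n. (\<psi> (d * e m - c) - \<psi> (e m)) * x m j) / real n\<bar> \<le> t" unfolding t_def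
      by (rule score_process_bound[OF n r k _ env tail]) (use x_bound j grid cd in auto)
    then have W: "\<bar>(\<Sum>i<n. \<psi> (d * e i - c) * x i j) / real n - g0\<bar> \<le> t"
      by (simp add: g0_def left_diff_distrib sum_subtractf diff_divide_distrib)
    have t: "t \<ge> 0" using W by linarith
    have "\<bar>(1 / real n) * (\<Sum>i<n. \<psi> (e i) * x i j)\<bar>
        \<le> Max ((\<lambda>j. \<bar>(1 / real n) * (\<Sum>i<n. \<psi> (e i) * x i j)\<bar>) ` {..<p})"
      using j by (intro Max_ge) auto
    then have "\<bar>g0\<bar> * exp L
        \<le> Max ((\<lambda>j. \<bar>(1 / real n) * (\<Sum>i<n. \<psi> (e i) * x i j)\<bar>) ` {..<p}) * exp L"
      by (intro mult_right_mono) (simp_all add: g0_def)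
    moreover have "L = - (1 / real n) * (\<Sum>i<n. ln (f (e i)))"
      by (simp add: L_def neg_log_def sum_negf)
    ultimately have "\<bar>g0\<bar> * exp L \<le> lambda_star f n p x e"
      by (simp only: lambda_star_def)
    then have g0: "exp L * \<bar>g0\<bar> \<le> q" using star by (simp add: mult.commute)
    have "exp Q * \<bar>(\<Sum>i<n. \<psi> (d * e i - c) * x i j) / real n\<bar> \<le> ((1 + r) * exp L) * (\<bar>g0\<bar> + t)"
      using W expQ r by (intro mult_mono) auto
    also have "\<dots> = (1 + r) * (exp L * \<bar>g0\<bar> + exp L * t)" by (simp add: algebra_simps)
    also have "\<dots> \<le> (1 + r) * (q + exp b * t)"
      using g0 t risk r by (intro mult_left_mono add_mono mult_right_mono) (auto simp: L_def)
    also have "\<dots> < lam" using lam by (simp add: t_def)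
    finally show ?thesis .
  qed
  show "\<exists>\<theta>. is_exp_lasso l n p x y lam \<theta>"
    by (rule exp_lasso_null_selection(1)[where l = l and \<psi> = \<psi> and x = x and y = y and e = e and c = c
        and ?b0.0 = b0, OF convex deriv_l n p d intercept y cd(4,5)])
      (use small Q_def in auto)
  show "\<beta> j = 0" if "is_exp_lasso l n p x y lam (\<beta>, \<sigma>)" "j \<in> {1..<p}" for \<beta> \<sigma> j
    by (rule exp_lasso_null_selection(2)[where l = l and \<psi> = \<psi> and x = x and y = y and e = e and c = c
        and ?b0.0 = b0, OF convex deriv_l n p d intercept y cd(4,5) _ that])
      (use small Q_def in auto)
qed

end

section \<open>Probability of the good event\<close>

locale noise_sample = regular_noise f G m0 + iid_sample M \<xi> "density lborel (\<lambda>t. ennreal (f t))"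
  for f G :: "real \<Rightarrow> real" and m0 :: real and M :: "'a measure" and \<xi> :: "nat \<Rightarrow> 'a \<Rightarrow> real"
begin

lemma trunc_score_measurable [measurable]: "trunc_score \<tau> c d \<in> borel_measurable borel"
  unfolding trunc_score_def[abs_def] by measurable

lemma env_tail_measurable [measurable]: "env_tail \<tau> \<in> borel_measurable borel"
  unfolding env_tail_def[abs_def] by measurable

lemma lambda_star_measurable [measurable]:
  "(\<lambda>\<omega>. lambda_star f n p x (\<lambda>i. \<xi> i \<omega>)) \<in> borel_measurable M"
  unfolding lambda_star_def by measurable

lemma env_tail_nonneg: "0 \<le> env_tail \<tau> t"
  by (simp add: env_tail_def env_nonneg)

lemma env_tail_bound: "\<tau> > 0 \<Longrightarrow> env_tail \<tau> t \<le> (env t)\<^sup>2 / \<tau>"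
  using env_nonneg[of t] by (auto simp: env_tail_def power2_eq_square field_simps)

lemma integrable_env_tail: "integrable \<mu> (env_tail \<tau>)"
  by (rule Bochner_Integration.integrable_bound[OF integrable_env]) (auto simp: env_tail_def)

lemma expectation_env_tail:
  assumes "\<tau> > 0"
  shows "(\<integral>t. env_tail \<tau> t \<partial>\<mu>) \<le> (\<integral>t. (env t)\<^sup>2 \<partial>\<mu>) / \<tau>"
proof -
  have "(\<integral>t. env_tail \<tau> t \<partial>\<mu>) \<le> (\<integral>t. (env t)\<^sup>2 / \<tau> \<partial>\<mu>)"
    by (rule integral_mono[OF integrable_env_tail]) (use integrable_env_sq env_tail_bound[OF assms] in auto)
  then show ?thesis by simp
qed

lemma second_moment_rem:
  assumes "max \<bar>c\<bar> \<bar>d - 1\<bar> \<le> r" "r \<le> m0"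
  shows "integrable \<mu> (\<lambda>t. (rem c d t)\<^sup>2)" "(\<integral>t. (rem c d t)\<^sup>2 \<partial>\<mu>) \<le> (\<integral>t. (env t)\<^sup>2 \<partial>\<mu>) * r ^ 4"
proof -
  have b: "(rem c d t)\<^sup>2 \<le> (env t)\<^sup>2 * r ^ 4" for t
  proof -
    have "(rem c d t)\<^sup>2 \<le> (env t * r\<^sup>2)\<^sup>2"
      using power_mono[OF rem_bound[OF assms, of t], of 2] by simp
    then show ?thesis by (simp add: power_mult_distrib)
  qed
  have int: "integrable \<mu> (\<lambda>t. (env t)\<^sup>2 * r ^ 4)" using integrable_env_sq by simp
  show int': "integrable \<mu> (\<lambda>t. (rem c d t)\<^sup>2)"
    by (rule Bochner_Integration.integrable_bound[OF int]) (use b in auto)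
  have "(\<integral>t. (rem c d t)\<^sup>2 \<partial>\<mu>) \<le> (\<integral>t. (env t)\<^sup>2 * r ^ 4 \<partial>\<mu>)"
    by (rule integral_mono[OF int' int b])
  then show "(\<integral>t. (rem c d t)\<^sup>2 \<partial>\<mu>) \<le> (\<integral>t. (env t)\<^sup>2 \<partial>\<mu>) * r ^ 4" by simp
qed

text \<open>The uniform bound admits the exponential moments; the bound by the envelope keeps the
  second moment of order \<open>r^2\<close>, independent of the truncation level.\<close>

lemma trunc_score_bound:
  assumes "max \<bar>c\<bar> \<bar>d - 1\<bar> \<le> r" "r \<le> m0" "\<tau> \<ge> 0"
  shows "\<bar>trunc_score \<tau> c d t\<bar> \<le> r * \<tau>" "\<bar>trunc_score \<tau> c d t\<bar> \<le> r * env t"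
proof -
  have r: "r \<ge> 0" using assms(1) by auto
  show "\<bar>trunc_score \<tau> c d t\<bar> \<le> r * env t"
    using score_lipschitz[OF assms(1,2), of t] env_nonneg[of t] r
    by (auto simp: trunc_score_def mult.commute)
  moreover have "r * env t \<le> r * \<tau>" if "env t \<le> \<tau>" using r that by (rule mult_left_mono[rotated])
  ultimately show "\<bar>trunc_score \<tau> c d t\<bar> \<le> r * \<tau>"
    using r assms(3) by (auto simp: trunc_score_def split: if_splits)
qed

lemma second_moment_trunc_score:
  assumes "max \<bar>c\<bar> \<bar>d - 1\<bar> \<le> r" "r \<le> m0" "\<tau> \<ge> 0"
  shows "(\<integral>t. (trunc_score \<tau> c d t)\<^sup>2 \<partial>\<mu>) \<le> r\<^sup>2 * (\<integral>t. (env t)\<^sup>2 \<partial>\<mu>)"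
proof -
  have b: "(trunc_score \<tau> c d t)\<^sup>2 \<le> r\<^sup>2 * (env t)\<^sup>2" for t
    using power_mono[OF trunc_score_bound(2)[OF assms, of t], of 2] by (simp add: power_mult_distrib)
  have int: "integrable \<mu> (\<lambda>t. r\<^sup>2 * (env t)\<^sup>2)" using integrable_env_sq by simp
  have int': "integrable \<mu> (\<lambda>t. (trunc_score \<tau> c d t)\<^sup>2)"
    by (rule Bochner_Integration.integrable_bound[OF int]) (use b in auto)
  have "(\<integral>t. (trunc_score \<tau> c d t)\<^sup>2 \<partial>\<mu>) \<le> (\<integral>t. r\<^sup>2 * (env t)\<^sup>2 \<partial>\<mu>)"
    by (rule integral_mono[OF int' int b])
  then show ?thesis by simp
qed

text \<open>\<open>E\<close> is the event that \<open>lambda_star\<close> is at most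
  \<open>q\<close>, minus seven failure events, whose probabilities are the seven subtracted terms
  in order. Existence of a minimiser is part of the conclusion, since an estimator can only be
  pinned down where one exists.\<close>

lemma null_selection_probability:
  fixes x :: "nat \<Rightarrow> nat \<Rightarrow> real" and y :: "nat \<Rightarrow> 'a \<Rightarrow> real"
  assumes n: "n \<ge> 1" and p: "p \<ge> 1" and r: "0 < r" "r \<le> m0" and k: "k \<ge> 1"
    and intercept: "\<And>i. i < n \<Longrightarrow> x i 0 = 1"
    and x_bound: "\<And>i j. i < n \<Longrightarrow> j < p \<Longrightarrow> \<bar>x i j\<bar> \<le> K" and K: "K > 0"
    and centered: "\<And>j. j \<in> {1..<p} \<Longrightarrow> (\<Sum>i<n. x i j) = 0"
    and y: "\<And>i \<omega>. i < n \<Longrightarrow> \<omega> \<in> space M \<Longrightarrow> y i \<omega> = b0 + \<xi> i \<omega>"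
    and \<kappa>: "\<kappa> > 0"
    and growth: "\<And>c d. max \<bar>c\<bar> \<bar>d - 1\<bar> = r \<Longrightarrow> \<kappa> * r\<^sup>2 \<le> (\<integral>t. rem c d t \<partial>\<mu>)"
    and pos: "a > 0" "b > 0" "\<tau> > 0" "t2 > 0"
    and s: "s \<ge> 0" "s * K * (r * \<tau>) \<le> 1"
    and mesh: "a < \<kappa> * real k / 4"
    and lam: "(1 + r) * (q + exp b * (t1 + t2 + K * a * (r / real k))) < lam"
  shows "\<exists>E\<in>sets M.
    (\<forall>\<omega>\<in>E. (\<exists>\<theta>. is_exp_lasso l n p x (\<lambda>i. y i \<omega>) lam \<theta>) \<and>
      (\<forall>\<beta> \<sigma>. is_exp_lasso l n p x (\<lambda>i. y i \<omega>) lam (\<beta>, \<sigma>) \<longrightarrow> (\<forall>j\<in>{1..<p}. \<beta> j = 0))) \<and>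
    prob {\<omega> \<in> space M. lambda_star f n p x (\<lambda>i. \<xi> i \<omega>) \<le> q}
      - ((\<integral>t. (\<psi> t)\<^sup>2 \<partial>\<mu>) / (real n * (\<kappa> * r / 8)\<^sup>2)
       + (\<integral>t. (\<psi> t * t)\<^sup>2 \<partial>\<mu>) / (real n * (\<kappa> * r / 8)\<^sup>2)
       + (\<integral>t. env t \<partial>\<mu>) / a
       + (\<integral>t. \<bar>l t\<bar> \<partial>\<mu>) / b
       + (\<integral>t. (env t)\<^sup>2 \<partial>\<mu>) / \<tau> / (t2 / (K * r))
       + (2 * real k + 1)\<^sup>2 * ((\<integral>t. (env t)\<^sup>2 \<partial>\<mu>) * r ^ 4 / (real n * (\<kappa> * r\<^sup>2 / 2)\<^sup>2))
       + real p * (2 * real k + 1)\<^sup>2 *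
          (2 * exp (real n * (s\<^sup>2 * K\<^sup>2 * (r\<^sup>2 * (\<integral>t. (env t)\<^sup>2 \<partial>\<mu>))) - s * (real n * t1))))
      \<le> prob E"
proof -
  have n0: "real n > 0" using n by simp
  define v where "v = (\<integral>t. (env t)\<^sup>2 \<partial>\<mu>)"
  define J where "J = {- int k..int k} \<times> {- int k..int k}"
  have J: "finite J" "real (card J) = (2 * real k + 1)\<^sup>2"
    by (simp_all add: J_def card_cartesian_product power2_eq_square)
  define C where "C ij = grid_coord r k (fst ij)" for ij :: "int \<times> int"
  define D where "D ij = 1 + grid_coord r k (snd ij)" for ij :: "int \<times> int"
  have box: "max \<bar>C ij\<bar> \<bar>D ij - 1\<bar> \<le> r" if "ij \<in> J" for ij
    using that grid_coord_bound[OF r(1) k] by (auto simp: C_def D_def J_def)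
  \<comment> \<open>Growth is required only on the boundary of the box, whereas the column scores
    must be controlled on the whole grid \<open>J\<close>.\<close>
  define J' where "J' = {ij \<in> J. max \<bar>fst ij\<bar> \<bar>snd ij\<bar> = int k}"
  have boundary: "max \<bar>C ij\<bar> \<bar>D ij - 1\<bar> = r" if ij: "ij \<in> J'" for ij
  proof -
    have "\<bar>fst ij\<bar> = int k \<or> \<bar>snd ij\<bar> = int k" using ij by (auto simp: J'_def max_def split: if_splits)
    then have "\<bar>C ij\<bar> = r \<or> \<bar>D ij - 1\<bar> = r"
      using grid_coord_boundary[OF r(1) k] by (auto simp: C_def D_def)
    then show ?thesis using box[of ij] ij by (auto simp: J'_def)
  qed
  define mean where "mean h \<omega> = (\<Sum>i<n. h (\<xi> i \<omega>)) / real n" for h :: "real \<Rightarrow> real" and \<omega>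
  define W where "W ij j \<omega> = (\<Sum>m<n. x m j * trunc_score \<tau> (C ij) (D ij) (\<xi> m \<omega>))" for ij j \<omega>
  have [measurable]: "mean h \<in> borel_measurable M" if "h \<in> borel_measurable borel" for h
    unfolding mean_def[abs_def] using that by measurable
  have [measurable]: "W ij j \<in> borel_measurable M" for ij j
    unfolding W_def[abs_def] by measurable
  define A where "A = {\<omega> \<in> space M. lambda_star f n p x (\<lambda>i. \<xi> i \<omega>) \<le> q}"
  define B1 where "B1 = {\<omega> \<in> space M. \<kappa> * r / 8 \<le> \<bar>mean \<psi> \<omega> - 0\<bar>}"
  define B2 where "B2 = {\<omega> \<in> space M. \<kappa> * r / 8 \<le> \<bar>mean (\<lambda>t. \<psi> t * t) \<omega> - 1\<bar>}"
  define B3 where "B3 = {\<omega> \<in> space M. a \<le> mean env \<omega>}"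
  \<comment> \<open>The loss can be negative, so Markov's inequality is applied to its
    modulus.\<close>
  define B4 where "B4 = {\<omega> \<in> space M. b \<le> mean (\<lambda>t. \<bar>l t\<bar>) \<omega>}"
  define B5 where "B5 = {\<omega> \<in> space M. t2 / (K * r) \<le> mean (env_tail \<tau>) \<omega>}"
  \<comment> \<open>The tolerance is half of the expected growth \<open>\<kappa> * r^2\<close>, so
    the empirical remainder retains the other half.\<close>
  define R where "R ij = {\<omega> \<in> space M. \<kappa> * r\<^sup>2 / 2 \<le> \<bar>mean (rem (C ij) (D ij)) \<omega> - (\<integral>t. rem (C ij) (D ij) t \<partial>\<mu>)\<bar>}" for ij
  define U where "U z = {\<omega> \<in> space M. real n * t1 \<le> W (snd z) (fst z) \<omega>}
    \<union> {\<omega> \<in> space M. real n * t1 \<le> - W (snd z) (fst z) \<omega>}" for z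
  define B6 where "B6 = (\<Union>ij\<in>J'. R ij)"
  define B7 where "B7 = (\<Union>z\<in>{1..<p} \<times> J. U z)"
  have J': "finite J'" "J' \<subseteq> J" using J by (auto simp: J'_def)
  have [measurable]: "A \<in> events" "B1 \<in> events" "B2 \<in> events" "B3 \<in> events" "B4 \<in> events" "B5 \<in> events"
    "R ij \<in> events" "U z \<in> events" for ij z
    unfolding A_def B1_def B2_def B3_def B4_def B5_def R_def U_def by measurable
  have [measurable]: "B6 \<in> events" "B7 \<in> events"
    unfolding B6_def B7_def using J J' by (auto intro!: sets.finite_UN)
  have P1: "prob B1 \<le> (\<integral>t. (\<psi> t)\<^sup>2 \<partial>\<mu>) / (real n * (\<kappa> * r / 8)\<^sup>2)"
    using mean_deviation_chebyshev[of \<psi> n "\<kappa> * r / 8"] moment_dl n \<kappa> r score_mean(1)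
    by (simp add: B1_def mean_def)
  have P2: "prob B2 \<le> (\<integral>t. (\<psi> t * t)\<^sup>2 \<partial>\<mu>) / (real n * (\<kappa> * r / 8)\<^sup>2)"
    using mean_deviation_chebyshev[of "\<lambda>t. \<psi> t * t" n "\<kappa> * r / 8"] moment_dl_id n \<kappa> r score_mean(2)
    by (simp add: B2_def mean_def)
  have P3: "prob B3 \<le> (\<integral>t. env t \<partial>\<mu>) / a"
    unfolding B3_def mean_def by (rule mean_tail_markov) (use integrable_env env_nonneg n pos in auto)
  have P4: "prob B4 \<le> (\<integral>t. \<bar>l t\<bar> \<partial>\<mu>) / b"
    unfolding B4_def mean_def by (rule mean_tail_markov) (use moment_l n pos in auto)
  have P5: "prob B5 \<le> v / \<tau> / (t2 / (K * r))"
  proof -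
    have "prob B5 \<le> (\<integral>t. env_tail \<tau> t \<partial>\<mu>) / (t2 / (K * r))"
      unfolding B5_def mean_def
      by (rule mean_tail_markov) (use integrable_env_tail env_tail_nonneg n pos K r in auto)
    also have "\<dots> \<le> v / \<tau> / (t2 / (K * r))"
      unfolding v_def using pos K r by (intro divide_right_mono expectation_env_tail) auto
    finally show ?thesis .
  qed
  have PR: "prob (R ij) \<le> v * r ^ 4 / (real n * (\<kappa> * r\<^sup>2 / 2)\<^sup>2)" if "ij \<in> J'" for ij
  proof -
    have bx: "max \<bar>C ij\<bar> \<bar>D ij - 1\<bar> \<le> r" by (rule box) (use that J' in blast)
    have "prob (R ij) \<le> (\<integral>t. (rem (C ij) (D ij) t)\<^sup>2 \<partial>\<mu>) / (real n * (\<kappa> * r\<^sup>2 / 2)\<^sup>2)"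
      unfolding R_def mean_def
      by (rule mean_deviation_chebyshev) (use second_moment_rem(1)[OF bx r(2)] n \<kappa> r in auto)
    also have "\<dots> \<le> v * r ^ 4 / (real n * (\<kappa> * r\<^sup>2 / 2)\<^sup>2)"
      unfolding v_def by (intro divide_right_mono second_moment_rem(2)[OF bx r(2)]) auto
    finally show ?thesis .
  qed
  have v: "v \<ge> 0" unfolding v_def by (intro integral_nonneg_AE) auto
  have P6: "prob B6 \<le> (2 * real k + 1)\<^sup>2 * (v * r ^ 4 / (real n * (\<kappa> * r\<^sup>2 / 2)\<^sup>2))"
  proof -
    have "prob B6 \<le> (\<Sum>ij\<in>J'. prob (R ij))"
      unfolding B6_def by (rule finite_measure_subadditive_finite) (use J' in auto)
    also have "\<dots> \<le> (\<Sum>ij\<in>J'. v * r ^ 4 / (real n * (\<kappa> * r\<^sup>2 / 2)\<^sup>2))" by (intro sum_mono PR)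
    also have "\<dots> = real (card J') * (v * r ^ 4 / (real n * (\<kappa> * r\<^sup>2 / 2)\<^sup>2))" by simp
    also have "\<dots> \<le> real (card J) * (v * r ^ 4 / (real n * (\<kappa> * r\<^sup>2 / 2)\<^sup>2))"
      using card_mono[OF J(1) J'(2)] v by (intro mult_right_mono) auto
    finally show ?thesis by (simp only: J(2))
  qed
  define X where "X = exp (real n * (s\<^sup>2 * K\<^sup>2 * (r\<^sup>2 * v)) - s * (real n * t1))"
  have PU: "prob (U z) \<le> 2 * X" if z: "z \<in> {1..<p} \<times> J" for z
  proof -
    obtain j ij where zj: "z = (j, ij)" by (cases z)
    have j: "j \<in> {1..<p}" and ij: "ij \<in> J" using z zj by auto
    note T = trunc_score_bound(1)[OF box[OF ij] r(2) less_imp_le[OF pos(3)]]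
    note T2 = second_moment_trunc_score[OF box[OF ij] r(2) less_imp_le[OF pos(3)], folded v_def]
    have 1: "prob {\<omega> \<in> space M. real n * t1 \<le> (\<Sum>i<n. x i j * trunc_score \<tau> (C ij) (D ij) (\<xi> i \<omega>))} \<le> X"
      unfolding X_def by (rule weighted_sum_chernoff[OF _ T])
        (use x_bound j centered[OF j] s T2 in auto)
    have 2: "prob {\<omega> \<in> space M. real n * t1 \<le> (\<Sum>i<n. (- x i j) * trunc_score \<tau> (C ij) (D ij) (\<xi> i \<omega>))} \<le> X"
      unfolding X_def by (rule weighted_sum_chernoff[OF _ T])
        (use x_bound j centered[OF j] s T2 in \<open>auto simp: sum_negf\<close>)
    have "prob (U z) \<le> prob {\<omega> \<in> space M. real n * t1 \<le> W ij j \<omega>} + prob {\<omega> \<in> space M. real n * t1 \<le> - W ij j \<omega>}"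
      unfolding U_def zj fst_conv snd_conv by (rule measure_Un_le) measurable
    then show ?thesis using 1 2 by (simp add: W_def sum_negf)
  qed
  have P7: "prob B7 \<le> real p * (2 * real k + 1)\<^sup>2 * (2 * X)"
  proof -
    have "prob B7 \<le> (\<Sum>z\<in>{1..<p} \<times> J. prob (U z))"
      unfolding B7_def by (rule finite_measure_subadditive_finite) (use J in auto)
    also have "\<dots> \<le> (\<Sum>z\<in>{1..<p} \<times> J. 2 * X)" by (intro sum_mono PU)
    also have "\<dots> = real (p - 1) * real (card J) * (2 * X)" by (simp add: card_cartesian_product)
    also have "\<dots> \<le> real p * real (card J) * (2 * X)" by (intro mult_right_mono) (auto simp: X_def)
    finally show ?thesis by (simp only: J(2))
  qed
  define B where "B = B1 \<union> B2 \<union> B3 \<union> B4 \<union> B5 \<union> B6 \<union> B7"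
  have [measurable]: "B \<in> events" unfolding B_def by measurable
  have "prob B \<le> prob B1 + prob B2 + prob B3 + prob B4 + prob B5 + prob B6 + prob B7"
    unfolding B_def by (intro order_trans[OF measure_Un_le] add_right_mono) auto
  moreover have "prob A \<le> prob (A - B) + prob B"
  proof -
    have "prob A \<le> prob ((A - B) \<union> B)" by (rule finite_measure_mono) auto
    also have "\<dots> \<le> prob (A - B) + prob B" by (rule measure_Un_le) auto
    finally show ?thesis .
  qed
  ultimately have PE: "prob A - ((\<integral>t. (\<psi> t)\<^sup>2 \<partial>\<mu>) / (real n * (\<kappa> * r / 8)\<^sup>2)
       + (\<integral>t. (\<psi> t * t)\<^sup>2 \<partial>\<mu>) / (real n * (\<kappa> * r / 8)\<^sup>2)
       + (\<integral>t. env t \<partial>\<mu>) / a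
       + (\<integral>t. \<bar>l t\<bar> \<partial>\<mu>) / b
       + v / \<tau> / (t2 / (K * r))
       + (2 * real k + 1)\<^sup>2 * (v * r ^ 4 / (real n * (\<kappa> * r\<^sup>2 / 2)\<^sup>2))
       + real p * (2 * real k + 1)\<^sup>2 * (2 * X)) \<le> prob (A - B)"
    using P1 P2 P3 P4 P5 P6 P7 by linarith
  have sel: "(\<exists>\<theta>. is_exp_lasso l n p x (\<lambda>i. y i \<omega>) lam \<theta>) \<and>
      (\<forall>\<beta> \<sigma>. is_exp_lasso l n p x (\<lambda>i. y i \<omega>) lam (\<beta>, \<sigma>) \<longrightarrow> (\<forall>j\<in>{1..<p}. \<beta> j = 0))"
    if \<omega>: "\<omega> \<in> A - B" for \<omega>
  proof -
    have sp: "\<omega> \<in> space M" using \<omega> by (auto simp: A_def)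
    have y': "y i \<omega> = b0 + \<xi> i \<omega>" if "i < n" for i using y[OF that sp] .
    have star: "lambda_star f n p x (\<lambda>i. \<xi> i \<omega>) \<le> q" using \<omega> by (simp add: A_def)
    have nB: "\<omega> \<notin> B1" "\<omega> \<notin> B2" "\<omega> \<notin> B3" "\<omega> \<notin> B4" "\<omega> \<notin> B5" "\<omega> \<notin> B6" "\<omega> \<notin> B7"
      using \<omega> by (auto simp: B_def)
    have c1: "\<bar>(\<Sum>i<n. \<psi> (\<xi> i \<omega>)) / real n\<bar> \<le> \<kappa> * r / 8"
      using nB(1) sp by (simp add: B1_def mean_def)
    have c2: "\<bar>(\<Sum>i<n. \<psi> (\<xi> i \<omega>) * \<xi> i \<omega>) / real n - 1\<bar> \<le> \<kappa> * r / 8"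
      using nB(2) sp by (simp add: B2_def mean_def)
    have c3: "(\<Sum>i<n. env (\<xi> i \<omega>)) / real n \<le> a"
      using nB(3) sp by (simp add: B3_def mean_def)
    have c4: "(\<Sum>i<n. l (\<xi> i \<omega>)) / real n \<le> b"
    proof -
      have "(\<Sum>i<n. l (\<xi> i \<omega>)) / real n \<le> mean (\<lambda>t. \<bar>l t\<bar>) \<omega>"
        unfolding mean_def by (intro divide_right_mono sum_mono) auto
      then show ?thesis using nB(4) sp by (simp add: B4_def)
    qed
    have c5: "K * r * ((\<Sum>i<n. env_tail \<tau> (\<xi> i \<omega>)) / real n) \<le> t2"
    proof -
      have Kr: "K * r > 0" using K r by simp
      have "mean (env_tail \<tau>) \<omega> \<le> t2 / (K * r)" using nB(5) sp by (simp add: B5_def)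
      then show ?thesis unfolding mean_def pos_le_divide_eq[OF Kr] by (simp only: mult.commute)
    qed
    have c6: "\<kappa> * r\<^sup>2 / 2 \<le> (\<Sum>m<n. rem (grid_coord r k i) (1 + grid_coord r k j) (\<xi> m \<omega>)) / real n"
      if "i \<in> {- int k..int k}" "j \<in> {- int k..int k}" "max \<bar>i\<bar> \<bar>j\<bar> = int k" for i j
    proof -
      have ij: "(i, j) \<in> J'" using that by (simp add: J'_def J_def)
      have "\<omega> \<notin> R (i, j)" using nB(6) ij unfolding B6_def by blast
      then have "\<bar>mean (rem (C (i, j)) (D (i, j))) \<omega> - (\<integral>t. rem (C (i, j)) (D (i, j)) t \<partial>\<mu>)\<bar> < \<kappa> * r\<^sup>2 / 2"
        using sp by (simp add: R_def)
      moreover have "\<kappa> * r\<^sup>2 \<le> (\<integral>t. rem (C (i, j)) (D (i, j)) t \<partial>\<mu>)"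
        by (rule growth[OF boundary[OF ij]])
      ultimately have "\<kappa> * r\<^sup>2 / 2 \<le> mean (rem (C (i, j)) (D (i, j))) \<omega>" by linarith
      then show ?thesis by (simp add: mean_def C_def D_def)
    qed
    have c7: "\<bar>\<Sum>m<n. x m h * trunc_score \<tau> (grid_coord r k i) (1 + grid_coord r k j) (\<xi> m \<omega>)\<bar> \<le> real n * t1"
      if "h \<in> {1..<p}" "i \<in> {- int k..int k}" "j \<in> {- int k..int k}" for h i j
    proof -
      have "\<omega> \<notin> U (h, (i, j))" using nB(7) that unfolding B7_def J_def by blast
      then have "\<bar>W (i, j) h \<omega>\<bar> \<le> real n * t1" using sp by (simp add: U_def abs_le_iff)
      then show ?thesis by (simp add: W_def C_def D_def)
    qed
    note fact = n p r k intercept x_bound y' c1 c2 c3 c6 mesh c4 c5 c7 star lam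
    show ?thesis
      using null_selection_deterministic(1)[of n p r k x K "\<lambda>i. y i \<omega>" b0 "\<lambda>i. \<xi> i \<omega>", OF fact]
        null_selection_deterministic(2)[of n p r k x K "\<lambda>i. y i \<omega>" b0 "\<lambda>i. \<xi> i \<omega>", OF fact] by blast
  qed
  show ?thesis
    by (rule bexI[of _ "A - B"]) (use sel PE in \<open>auto simp: A_def[symmetric] v_def[symmetric] X_def[symmetric]\<close>)
qed

text \<open>The free parameters are fixed here: \<open>a = N\<close>, \<open>b = ln N\<close>,
  \<open>\<tau> = 1 / R\<close>, \<open>t1 = t2 = \<eta> * R / N^2\<close> and
  \<open>s = R / (K * r)\<close> with \<open>R = sqrt (ln p / n)\<close>; \<open>g\<close> stands
  for an upper bound on \<open>K / \<eta>\<close>. The remaining error terms depend on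
  \<open>p\<close>, \<open>K\<close> and \<open>\<eta>\<close> no longer.\<close>

lemma null_selection_rate:
  fixes x :: "nat \<Rightarrow> nat \<Rightarrow> real" and y :: "nat \<Rightarrow> 'a \<Rightarrow> real" and N g h C v W :: real
  defines "v \<equiv> (\<integral>t. (env t)\<^sup>2 \<partial>\<mu>)"
    and "W \<equiv> (\<integral>t. (\<psi> t)\<^sup>2 \<partial>\<mu>) + (\<integral>t. (\<psi> t * t)\<^sup>2 \<partial>\<mu>)"
  assumes n: "n \<ge> 1" and p: "p \<ge> 1" and r: "0 < r" "r \<le> m0" and k: "k \<ge> 1"
    and intercept: "\<And>i. i < n \<Longrightarrow> x i 0 = 1"
    and x_bound: "\<And>i j. i < n \<Longrightarrow> j < p \<Longrightarrow> \<bar>x i j\<bar> \<le> K" and K: "K \<ge> 1"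
    and centered: "\<And>j. j \<in> {1..<p} \<Longrightarrow> (\<Sum>i<n. x i j) = 0"
    and y: "\<And>i \<omega>. i < n \<Longrightarrow> \<omega> \<in> space M \<Longrightarrow> y i \<omega> = b0 + \<xi> i \<omega>"
    and \<kappa>: "\<kappa> > 0"
    and growth: "\<And>c d. max \<bar>c\<bar> \<bar>d - 1\<bar> = r \<Longrightarrow> \<kappa> * r\<^sup>2 \<le> (\<integral>t. rem c d t \<partial>\<mu>)"
    and \<eta>: "0 < \<eta>" "\<eta> < 1" and g: "g > 0" "K \<le> \<eta> * g"
    and N: "N > 1" "12 * C \<le> N" "N < \<kappa> * real k / 4"
    and mesh: "g * N ^ 3 * (r / real k) \<le> 1 / sqrt (real n)"
    and r_small: "4 * r * g \<le> 1"
    and log_p: "1 \<le> ln (real p)"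
    and lam: "0 < lam" "sqrt (ln (real p) / real n) \<le> C * lam" "q \<le> (1 - \<eta>) * lam"
    and h: "h = 1 / (N\<^sup>2 * g * r)" "1 + v \<le> h"
  shows "\<exists>E\<in>sets M.
    (\<forall>\<omega>\<in>E. (\<exists>\<theta>. is_exp_lasso l n p x (\<lambda>i. y i \<omega>) lam \<theta>) \<and>
      (\<forall>\<beta> \<sigma>. is_exp_lasso l n p x (\<lambda>i. y i \<omega>) lam (\<beta>, \<sigma>) \<longrightarrow> (\<forall>j\<in>{1..<p}. \<beta> j = 0))) \<and>
    prob {\<omega> \<in> space M. lambda_star f n p x (\<lambda>i. \<xi> i \<omega>) \<le> q}
      - (64 * W / \<kappa>\<^sup>2 * (1 / (real n * r\<^sup>2))
       + (\<integral>t. env t \<partial>\<mu>) / N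
       + (\<integral>t. \<bar>l t\<bar> \<partial>\<mu>) / ln N
       + v * (g * r * N\<^sup>2)
       + (2 * real k + 1)\<^sup>2 * (4 * v / \<kappa>\<^sup>2 * (1 / real n))
       + (2 * real k + 1)\<^sup>2 * (2 * exp (1 + v - h)))
      \<le> prob E"
proof -
  have n0: "real n > 0" and K0: "K > 0" and N0: "N > 0" using n K N by auto
  have p0: "real p > 0" using p by simp
  define R where "R = sqrt (ln (real p) / real n)"
  have R2: "R\<^sup>2 = ln (real p) / real n" using n0 log_p by (simp add: R_def)
  have R: "R > 0" "real n * R\<^sup>2 = ln (real p)" "1 / sqrt (real n) \<le> R"
    using n0 log_p by (simp add: R_def, simp add: R2, simp add: R_def real_sqrt_divide divide_right_mono)
  \<comment> \<open>Of the two factors \<open>1 / N\<close>, one compensates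
    \<open>exp b = N\<close> and the other absorbs the constant in
    \<open>R <= C * lam\<close>.\<close>
  define t1 where "t1 = \<eta> * R / N\<^sup>2"
  have t1: "t1 > 0" using \<eta> R N0 by (simp add: t1_def)
  \<comment> \<open>The largest value allowed by the boundedness condition
    \<open>s * K * (r * \<tau>) <= 1\<close> at \<open>\<tau> = 1 / R\<close>.\<close>
  define s where "s = R / (K * r)"
  have v0: "v \<ge> 0" unfolding v_def by (intro integral_nonneg_AE) auto
  have skr: "s * K * (r * (1 / R)) \<le> 1" using K0 r R by (simp add: s_def)
  have small_mesh: "K * N * (r / real k) \<le> t1"
  proof -
    have "K * N * (r / real k) \<le> (\<eta> * g) * N * (r / real k)"
      using g N0 r by (intro mult_right_mono) auto
    also have "\<dots> = \<eta> * (g * N ^ 3 * (r / real k)) / N\<^sup>2"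
      using N0 by (simp add: power2_eq_square power3_eq_cube)
    also have "\<dots> \<le> \<eta> * R / N\<^sup>2"
      using mesh R(3) \<eta> N0 by (intro divide_right_mono mult_left_mono) auto
    finally show ?thesis by (simp add: t1_def)
  qed
  \<comment> \<open>All three errors are at most \<open>t1\<close>, for a total of
    \<open>3 * \<eta> * R / N\<close>; \<open>12 * C <= N\<close> brings this below a quarter of the
    gap \<open>\<eta> * lam\<close>.\<close>
  have "exp (ln N) * (t1 + t1 + K * N * (r / real k)) \<le> N * (3 * t1)"
    using small_mesh N0 by (simp add: mult_left_mono)
  also have "\<dots> = 3 * \<eta> * R / N" using N0 by (simp add: t1_def power2_eq_square)
  also have "\<dots> \<le> 3 * \<eta> * (C * lam) / N"
    using lam(2) \<eta> N0 by (intro divide_right_mono mult_left_mono) (auto simp: R_def)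
  also have "\<dots> = 12 * C * (\<eta> * lam) / (4 * N)" by simp
  also have "\<dots> \<le> N * (\<eta> * lam) / (4 * N)"
    using N \<eta> lam(1) by (intro divide_right_mono mult_right_mono) auto
  also have "\<dots> = \<eta> * lam / 4" using N0 by simp
  finally have dev: "exp (ln N) * (t1 + t1 + K * N * (r / real k)) \<le> \<eta> * lam / 4" .
  \<comment> \<open>Since \<open>K >= 1\<close>, the bound \<open>K <= \<eta> * g\<close> forces
    \<open>\<eta> * g >= 1\<close>, which turns the condition on \<open>r * g\<close> into one on
    \<open>r / \<eta>\<close>. The inflation \<open>1 + r\<close> then fits into the gap as
    well.\<close>
  have r\<eta>: "r \<le> \<eta> / 4"
  proof -
    have "4 * r * g \<le> \<eta> * g" using r_small K g by linarith
    then show ?thesis using g by simp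
  qed
  have "(1 + r) * (q + exp (ln N) * (t1 + t1 + K * N * (r / real k)))
      \<le> (1 + r) * ((1 - \<eta>) * lam + \<eta> * lam / 4)"
    using dev lam(3) r by (intro mult_left_mono add_mono) auto
  also have "\<dots> = (1 + r) * (1 - 3 / 4 * \<eta>) * lam" by (simp add: algebra_simps)
  also have "\<dots> \<le> (1 + \<eta> / 4) * (1 - 3 / 4 * \<eta>) * lam"
    using r\<eta> \<eta> lam(1) by (intro mult_right_mono) auto
  also have "(1 + \<eta> / 4) * (1 - 3 / 4 * \<eta>) * lam < 1 * lam"
  proof (rule mult_strict_right_mono[OF _ lam(1)])
    have "(1 + \<eta> / 4) * (1 - 3 / 4 * \<eta>) = 1 - \<eta> / 2 - 3 / 16 * (\<eta> * \<eta>)" by (simp add: algebra_simps)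
    moreover have "\<eta> * \<eta> \<ge> 0" by simp
    ultimately show "(1 + \<eta> / 4) * (1 - 3 / 4 * \<eta>) < 1" using \<eta> by linarith
  qed
  finally have lam': "(1 + r) * (q + exp (ln N) * (t1 + t1 + K * N * (r / real k))) < lam" by simp
  have lnN: "ln N > 0" using N by simp
  have s0: "s \<ge> 0" using R K0 r by (simp add: s_def)
  have tau: "1 / R > 0" using R by simp
  note core = null_selection_probability[of n p r k x K y b0 \<kappa> N "ln N" "1 / R" t1 s q t1 lam,
    OF n p r k intercept x_bound K0 centered y \<kappa> growth N0 lnN tau t1 s0 skr N(3) lam']
  have e1: "(\<integral>t. (\<psi> t)\<^sup>2 \<partial>\<mu>) / (real n * (\<kappa> * r / 8)\<^sup>2) + (\<integral>t. (\<psi> t * t)\<^sup>2 \<partial>\<mu>) / (real n * (\<kappa> * r / 8)\<^sup>2)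
      = 64 * W / \<kappa>\<^sup>2 * (1 / (real n * r\<^sup>2))"
    by (simp add: W_def add_divide_distrib[symmetric] power_divide power_mult_distrib mult_ac)
  have "K / \<eta> \<le> g" using g(2) \<eta> by (simp add: divide_le_eq mult.commute)
  have e5: "v / (1 / R) / (t1 / (K * r)) \<le> v * (g * r * N\<^sup>2)"
  proof -
    have "v / (1 / R) / (t1 / (K * r)) = v * (K / \<eta> * r * N\<^sup>2)"
      using R K0 r \<eta> N0 by (simp add: t1_def)
    also have "\<dots> \<le> v * (g * r * N\<^sup>2)"
      using \<open>K / \<eta> \<le> g\<close> v0 r by (intro mult_left_mono mult_right_mono) auto
    finally show ?thesis .
  qed
  have e6: "v * r ^ 4 / (real n * (\<kappa> * r\<^sup>2 / 2)\<^sup>2) = 4 * v / \<kappa>\<^sup>2 * (1 / real n)"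
    using r by (simp add: power_divide power_mult_distrib mult_ac)
  \<comment> \<open>Both parts of the exponent are multiples of \<open>ln p\<close>: the variance
    gives \<open>v\<close>, the threshold at least \<open>h\<close>, and the union over columns adds
    1. As \<open>1 + v - h <= 0\<close> and \<open>ln p >= 1\<close>, the factor \<open>ln p\<close>
    may be dropped.\<close>
  have e7: "real p * exp (real n * (s\<^sup>2 * K\<^sup>2 * (r\<^sup>2 * v)) - s * (real n * t1)) \<le> exp (1 + v - h)"
  proof -
    have "real n * (s\<^sup>2 * K\<^sup>2 * (r\<^sup>2 * v)) = real n * R\<^sup>2 * v"
      using K0 r by (simp add: s_def power_divide power_mult_distrib)
    then have i: "real n * (s\<^sup>2 * K\<^sup>2 * (r\<^sup>2 * v)) = ln (real p) * v" using R by simp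
    have "s * (real n * t1) = real n * R\<^sup>2 * (1 / (N\<^sup>2 * (K / \<eta>) * r))"
      using \<eta> by (simp add: s_def t1_def power2_eq_square mult_ac)
    also have "\<dots> = ln (real p) * (1 / (N\<^sup>2 * (K / \<eta>) * r))" using R by simp
    also have "\<dots> \<ge> ln (real p) * h"
      unfolding h(1) using log_p \<open>K / \<eta> \<le> g\<close> N0 r K0 \<eta> g
      by (intro mult_left_mono divide_left_mono mult_right_mono mult_pos_pos) auto
    finally have ii: "s * (real n * t1) \<ge> ln (real p) * h" .
    have "real p * exp (real n * (s\<^sup>2 * K\<^sup>2 * (r\<^sup>2 * v)) - s * (real n * t1))
        \<le> exp (ln (real p)) * exp (ln (real p) * v - ln (real p) * h)"
    proof (rule mult_mono)
      have "real n * (s\<^sup>2 * K\<^sup>2 * (r\<^sup>2 * v)) - s * (real n * t1) \<le> ln (real p) * v - ln (real p) * h"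
        using i ii by linarith
      then show "exp (real n * (s\<^sup>2 * K\<^sup>2 * (r\<^sup>2 * v)) - s * (real n * t1))
          \<le> exp (ln (real p) * v - ln (real p) * h)" by (rule iffD2[OF exp_le_cancel_iff])
    qed (use p0 in auto)
    also have "\<dots> = exp (ln (real p) * (1 + v - h))" by (simp add: exp_add[symmetric] algebra_simps)
    also have "\<dots> \<le> exp (1 * (1 + v - h))"
      using mult_right_mono_neg[OF log_p, of "1 + v - h"] h(2) by simp
    finally show ?thesis by simp
  qed
  have e7': "real p * (2 * real k + 1)\<^sup>2 * (2 * exp (real n * (s\<^sup>2 * K\<^sup>2 * (r\<^sup>2 * v)) - s * (real n * t1)))
      \<le> (2 * real k + 1)\<^sup>2 * (2 * exp (1 + v - h))"
  proof -
    have "real p * (2 * real k + 1)\<^sup>2 * (2 * exp (real n * (s\<^sup>2 * K\<^sup>2 * (r\<^sup>2 * v)) - s * (real n * t1)))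
        = (2 * real k + 1)\<^sup>2 * (2 * (real p * exp (real n * (s\<^sup>2 * K\<^sup>2 * (r\<^sup>2 * v)) - s * (real n * t1))))"
      by (simp only: mult_ac)
    also have "\<dots> \<le> (2 * real k + 1)\<^sup>2 * (2 * exp (1 + v - h))"
      using e7 by (intro mult_left_mono) auto
    finally show ?thesis .
  qed
  obtain E where E: "E \<in> events" "\<forall>\<omega>\<in>E. (\<exists>\<theta>. is_exp_lasso l n p x (\<lambda>i. y i \<omega>) lam \<theta>) \<and>
      (\<forall>\<beta> \<sigma>. is_exp_lasso l n p x (\<lambda>i. y i \<omega>) lam (\<beta>, \<sigma>) \<longrightarrow> (\<forall>j\<in>{1..<p}. \<beta> j = 0))"
    and PE: "prob {\<omega> \<in> space M. lambda_star f n p x (\<lambda>i. \<xi> i \<omega>) \<le> q}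
      - ((\<integral>t. (\<psi> t)\<^sup>2 \<partial>\<mu>) / (real n * (\<kappa> * r / 8)\<^sup>2)
       + (\<integral>t. (\<psi> t * t)\<^sup>2 \<partial>\<mu>) / (real n * (\<kappa> * r / 8)\<^sup>2)
       + (\<integral>t. env t \<partial>\<mu>) / N
       + (\<integral>t. \<bar>l t\<bar> \<partial>\<mu>) / ln N
       + v / (1 / R) / (t1 / (K * r))
       + (2 * real k + 1)\<^sup>2 * (v * r ^ 4 / (real n * (\<kappa> * r\<^sup>2 / 2)\<^sup>2))
       + real p * (2 * real k + 1)\<^sup>2 *
          (2 * exp (real n * (s\<^sup>2 * K\<^sup>2 * (r\<^sup>2 * v)) - s * (real n * t1))))
      \<le> prob E"
    using core unfolding v_def by blast
  show ?thesis
    by (rule bexI[OF _ E(1)], rule conjI[OF E(2)]) (use PE e1 e5 e7' in \<open>unfold e6, linarith\<close>)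
qed

end

section \<open>The limit\<close>

text \<open>The probability bound is stated through a measurable \<open>E\<close> inside the
  selection event because \<open>\<beta>hat\<close> is an arbitrary selection of minimisers, not
  assumed measurable in \<open>\<omega>\<close>. It is tied to the minimisation only where a
  minimiser exists, which holds on the \<open>E\<close> constructed.\<close>

theorem lemma4p1:
  fixes M :: "'a measure"
    and \<xi> :: "nat \<Rightarrow> 'a \<Rightarrow> real"
    and f G :: "real \<Rightarrow> real"
    and p :: "nat \<Rightarrow> nat"
    and x :: "nat \<Rightarrow> nat \<Rightarrow> nat \<Rightarrow> real"
    and y :: "nat \<Rightarrow> nat \<Rightarrow> 'a \<Rightarrow> real"
    and \<beta>star :: "nat \<Rightarrow> nat \<Rightarrow> real"
    and \<sigma>star :: real
    and Kx smax \<alpha> \<eta> lam :: "nat \<Rightarrow> real"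
    and \<Sigma> :: "nat \<Rightarrow> real mat"
    and \<Lambda>x :: real
    and \<beta>hat :: "nat \<Rightarrow> 'a \<Rightarrow> nat \<Rightarrow> real"
    and \<sigma>hat :: "nat \<Rightarrow> 'a \<Rightarrow> real"
    and Finv :: "nat \<Rightarrow> real \<Rightarrow> real"
  assumes prob: "prob_space M"
    \<comment> \<open>The linear model with intercept, and the exp-Lasso estimator.\<close>
    and dim: "\<And>n. n \<ge> 1 \<Longrightarrow> p n \<ge> 1"
    and intercept: "\<And>n i. n \<ge> 1 \<Longrightarrow> i < n \<Longrightarrow> x n i 0 = 1"
    and model: "\<And>n i \<omega>. n \<ge> 1 \<Longrightarrow> i < n \<Longrightarrow> \<omega> \<in> space M \<Longrightarrow>
        y n i \<omega> = lin_pred (p n) (x n i) (\<beta>star n) + \<sigma>star * \<xi> i \<omega>"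
    and sigma_star: "\<sigma>star = 1"
    and estimator: "\<And>n \<omega>. n \<ge> 1 \<Longrightarrow> \<omega> \<in> space M \<Longrightarrow>
        (\<exists>\<theta>. is_exp_lasso (neg_log f) n (p n) (x n) (\<lambda>i. y n i \<omega>) (lam n) \<theta>) \<Longrightarrow>
        is_exp_lasso (neg_log f) n (p n) (x n) (\<lambda>i. y n i \<omega>) (lam n) (\<beta>hat n \<omega>, \<sigma>hat n \<omega>)"
    and quantile: "\<And>n. n \<ge> 1 \<Longrightarrow> Finv n = quantile_fun
        (cdf (distr M borel (\<lambda>\<omega>. lambda_star f n (p n) (x n) (\<lambda>i. \<xi> i \<omega>))))"
    \<comment> \<open>(1)\<close>
    and indep: "prob_space.indep_vars M (\<lambda>_. borel) \<xi> UNIV"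
    and distributed: "\<And>i. distributed M lborel (\<xi> i) (\<lambda>t. ennreal (f t))"
    and f_pos: "\<And>t. f t > 0"
    and convex: "convex_on UNIV (neg_log f)"
    and differentiable: "\<And>t. neg_log f field_differentiable (at t)"
    and moment_l: "integrable (density lborel f) (neg_log f)"
    and moment_dl: "integrable (density lborel f) (\<lambda>t. (deriv (neg_log f) t)\<^sup>2)"
    and moment_dl_id: "integrable (density lborel f) (\<lambda>t. (deriv (neg_log f) t * t)\<^sup>2)"
    \<comment> \<open>(2)\<close>
    and x_bound: "\<And>n i j. n \<ge> 1 \<Longrightarrow> i < n \<Longrightarrow> j < p n \<Longrightarrow> \<bar>x n i j\<bar> \<le> Kx n"
    and Kx_ge: "\<And>n. n \<ge> 1 \<Longrightarrow> Kx n \<ge> 1"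
    \<comment> \<open>(3)\<close>
    and G_pos: "\<And>t. G t > 0"
    and moment_G: "integrable (density lborel f) (\<lambda>t. (G t)\<^sup>2)"
    and moment_G_id: "integrable (density lborel f) (\<lambda>t. (G t)\<^sup>2 * t ^ 4)"
    and lipschitz: "\<And>n. n \<ge> 1 \<Longrightarrow> \<exists>m0>0. \<forall>m. 0 < m \<and> m \<le> m0 \<longrightarrow>
        (\<forall>t u v. max \<bar>u\<bar> \<bar>v\<bar> \<le> (Kx n + \<bar>t\<bar>) * m \<longrightarrow>
           \<bar>deriv (neg_log f) (t + u) - deriv (neg_log f) (t + v)\<bar> \<le> G t * \<bar>u - v\<bar>)"
    \<comment> \<open>(4)\<close>
    and hessian: "\<exists>r>0. \<exists>A.
        (\<forall>z\<in>{z. \<bar>z $ 1\<bar> + \<bar>z $ 2 - 1\<bar> < r}. has_hessian (expected_nll f) (A z) z) \<and>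
        continuous_on {z. \<bar>z $ 1\<bar> + \<bar>z $ 2 - 1\<bar> < r} A \<and>
        positive_definite (A (vector [0, 1]))"
    \<comment> \<open>(5)\<close>
    and p_lim: "filterlim p at_top sequentially"
    and log_p: "(\<lambda>n. ln (real (p n)) / real n) \<longlonglongrightarrow> 0"
    \<comment> \<open>(6)\<close>
    and Sigma_dim: "\<And>n. n \<ge> 1 \<Longrightarrow> \<Sigma> n \<in> carrier_mat (p n) (p n)"
    and Lambda_pos: "\<Lambda>x\<^sup>2 > 0"
    and Sigma_eig: "\<And>n. n \<ge> 1 \<Longrightarrow> smallest_eigenvalue (\<Sigma> n) (\<Lambda>x\<^sup>2)"
    and Sigma_approx: "asymp_lesssim (\<lambda>n. max_abs_entry (p n) (emp_gram n (p n) (x n) - \<Sigma> n))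
        (\<lambda>n. (Kx n)\<^sup>2 * sqrt (ln (real (p n)) / real n))"
    \<comment> \<open>(7)\<close>
    and alpha: "(\<exists>a. 0 < a \<and> a < 1 / 2 \<and> (\<forall>n\<ge>1. \<alpha> n = a)) \<or> (\<forall>n\<ge>1. \<alpha> n = 1 / real (p n))"
    and quantile_order: "asymp_equiv_order (\<lambda>n. Finv n (1 - \<alpha> n))
        (\<lambda>n. sqrt (ln (real (p n)) / real n))"
    \<comment> \<open>(8)\<close>
    and sparsity: "\<And>n. n \<ge> 1 \<Longrightarrow> real (card {j\<in>{1..<p n}. \<beta>star n j \<noteq> 0}) \<le> smax n"
    and smax_ge: "\<And>n. n \<ge> 1 \<Longrightarrow> smax n \<ge> 1"
    and smax_order: "asymp_ll smax
        (\<lambda>n. \<Lambda>x\<^sup>2 * sqrt (real n / ln (real (p n))) / (Kx n)\<^sup>2)"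
    \<comment> \<open>(9)\<close>
    and centered: "\<And>n j. n \<ge> 1 \<Longrightarrow> j \<in> {1..<p n} \<Longrightarrow> (\<Sum>i<n. x n i j) = 0"
    \<comment> \<open>(10)\<close>
    and eta_range: "\<And>n. n \<ge> 1 \<Longrightarrow> 0 < \<eta> n \<and> \<eta> n < 1"
    and eta_away: "asymp_lesssim (\<lambda>n. 1) (\<lambda>n. 1 - \<eta> n)"
    and eta_order: "asymp_ll
        (\<lambda>n. smax n * sqrt (ln (real (p n)) / real n) * (Kx n)\<^sup>2 / \<Lambda>x\<^sup>2) (\<lambda>n. (\<eta> n)\<^sup>2)"
    and lam_order: "asymp_equiv_order lam (\<lambda>n. sqrt (ln (real (p n)) / real n))"
    and lam_ge: "\<And>n. n \<ge> 1 \<Longrightarrow> lam n \<ge> Finv n (1 - \<alpha> n) / (1 - \<eta> n)"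
    \<comment> \<open>the null hypothesis\<close>
    and H0: "\<And>n j. n \<ge> 1 \<Longrightarrow> j \<in> {1..<p n} \<Longrightarrow> \<beta>star n j = 0"
  shows "\<exists>\<epsilon>::nat \<Rightarrow> real. \<epsilon> \<longlonglongrightarrow> 0 \<and>
    (\<forall>n\<ge>1. \<exists>E\<in>sets M. E \<subseteq> {\<omega> \<in> space M. \<forall>j\<in>{1..<p n}. \<beta>hat n \<omega> j = 0} \<and>
       measure M E \<ge> 1 - \<alpha> n + \<epsilon> n)"
proof -
  interpret P: prob_space M by (rule prob)
  (* The radius in the Lipschitz hypothesis may depend on n; since Kx 1 >= 1 and f, G do not
     depend on n, its instance at n = 1 gives a radius that serves for all n. *)
  obtain m1 where m1: "m1 > 0" and lip1: "\<And>t u v. max \<bar>u\<bar> \<bar>v\<bar> \<le> (Kx 1 + \<bar>t\<bar>) * m1 \<Longrightarrow>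
      \<bar>deriv (neg_log f) (t + u) - deriv (neg_log f) (t + v)\<bar> \<le> G t * \<bar>u - v\<bar>"
    using lipschitz[of 1] by force
  define m0 where "m0 = min m1 (1 / 2)"
  have m0: "0 < m0" "m0 < 1" "m0 \<le> m1" using m1 by (auto simp: m0_def)
  have lip: "\<bar>deriv (neg_log f) (t + u) - deriv (neg_log f) (t + v)\<bar> \<le> G t * \<bar>u - v\<bar>"
    if "max \<bar>u\<bar> \<bar>v\<bar> \<le> (1 + \<bar>t\<bar>) * m0" for t u v
  proof (rule lip1)
    have "(1 + \<bar>t\<bar>) * m0 \<le> (Kx 1 + \<bar>t\<bar>) * m1" using m0 Kx_ge[of 1] by (intro mult_mono) auto
    with that show "max \<bar>u\<bar> \<bar>v\<bar> \<le> (Kx 1 + \<bar>t\<bar>) * m1" by linarith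
  qed
  \<comment> \<open>\<open>distributed\<close> speaks of \<open>ennreal (f t)\<close>; positivity of
    \<open>f\<close> allows the return to the reals.\<close>
  have f_meas: "f \<in> borel_measurable borel"
  proof -
    have "(\<lambda>t. ennreal (f t)) \<in> borel_measurable lborel"
      using distributed_borel_measurable[OF distributed] .
    then have "(\<lambda>t. enn2real (ennreal (f t))) \<in> borel_measurable borel" by measurable
    then show ?thesis using f_pos by (simp add: less_imp_le)
  qed
  have distr_\<xi>: "distr M borel (\<xi> i) = density lborel (\<lambda>t. ennreal (f t))" for i
  proof -
    have "distr M borel (\<xi> i) = distr M lborel (\<xi> i)" by (rule distr_cong) auto
    then show ?thesis using distributed_distr_eq_density[OF distributed] by simp
  qed
  have \<xi>_meas: "\<xi> i \<in> borel_measurable M" for i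
    using indep by (auto simp: P.indep_vars_def)
  have prob_density: "prob_space (density lborel (\<lambda>t. ennreal (f t)))"
    using P.prob_space_distr[OF \<xi>_meas[of 0]] unfolding distr_\<xi> .
  interpret noise_sample f G m0 M \<xi>
    by (intro noise_sample.intro regular_noise.intro iid_sample.intro iid_sample_axioms.intro)
      (fact f_meas prob_density f_pos convex differentiable moment_l moment_dl moment_dl_id G_pos
        moment_G moment_G_id m0 lip prob indep distr_\<xi>)+
  obtain r0 A where r0: "r0 > 0" and
    hess: "\<And>z. \<bar>z $ 1\<bar> + \<bar>z $ 2 - 1\<bar> < r0 \<Longrightarrow> has_hessian (expected_nll f) (A z) z" and
    posdef: "positive_definite (A (vector [0, 1]))"
    using hessian by blast
  have hess1: "has_hessian (expected_nll f) (A (vector [0, 1])) (vector [0, 1])"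
    using hess[of "vector [0, 1]"] r0 by simp
  obtain \<kappa> \<delta> where \<kappa>: "\<kappa> > 0" and \<delta>: "\<delta> > 0" and
    growth: "\<And>c d. max \<bar>c\<bar> \<bar>d - 1\<bar> < \<delta> \<Longrightarrow> \<kappa> * (max \<bar>c\<bar> \<bar>d - 1\<bar>)\<^sup>2 \<le> (\<integral>t. rem c d t \<partial>\<mu>)"
    by (rule expectation_rem_growth[OF hess1 posdef]) (rule that)
  define v where "v = (\<integral>t. (env t)\<^sup>2 \<partial>\<mu>)"
  define W where "W = (\<integral>t. (\<psi> t)\<^sup>2 \<partial>\<mu>) + (\<integral>t. (\<psi> t * t)\<^sup>2 \<partial>\<mu>)"
  (* Kx n / eta n <= g n holds eventually by the condition on eta.  The box of radius r = n^(-2/5) is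
     large compared with n^(-1/2), so that it traps the location-scale minimiser, while
     g * r = n^(-3/20) -> 0 makes the score fluctuations over it negligible.  N = n^(1/100) is a
     slowly diverging factor that absorbs all constants, and the mesh r / k is about n^(-4/5). *)
  define R where "R n = sqrt (ln (real (p n)) / real n)" for n
  define N where "N n = real n powr (1 / 100)" for n
  define g where "g n = real n powr (1 / 4)" for n
  define r where "r n = real n powr (- 2 / 5)" for n
  define h where "h n = real n powr (13 / 100)" for n
  define k where "k n = nat \<lceil>real n powr (2 / 5)\<rceil>" for n
  define err where "err n = 64 * W / \<kappa>\<^sup>2 * (1 / (real n * (r n)\<^sup>2))
       + (\<integral>t. env t \<partial>\<mu>) / N n
       + (\<integral>t. \<bar>l t\<bar> \<partial>\<mu>) / ln (N n)
       + v * (g n * r n * (N n)\<^sup>2)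
       + (2 * real (k n) + 1)\<^sup>2 * (4 * v / \<kappa>\<^sup>2 * (1 / real n))
       + (2 * real (k n) + 1)\<^sup>2 * (2 * exp (1 + v - h n))" for n
  have k_le: "real (k n) \<le> real n powr (2 / 5) + 1" and k_ge: "real n powr (2 / 5) \<le> real (k n)" for n
  proof -
    have "real (k n) = real_of_int \<lceil>real n powr (2 / 5)\<rceil>" by (simp add: k_def)
    then show "real (k n) \<le> real n powr (2 / 5) + 1" "real n powr (2 / 5) \<le> real (k n)" by linarith+
  qed
  \<comment> \<open>The ceiling is replaced by a real power so that the limits concern explicit
    functions of \<open>n\<close>.\<close>
  have k_sq: "(2 * real (k n) + 1)\<^sup>2 \<le> (2 * real n powr (2 / 5) + 3)\<^sup>2" for n
    using k_le[of n] by (intro power_mono) auto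
  have err_lim: "err \<longlonglongrightarrow> 0"
  proof -
    have l1: "(\<lambda>n. 1 / (real n * (r n)\<^sup>2)) \<longlonglongrightarrow> 0" unfolding r_def by real_asymp
    have l2: "(\<lambda>n. c / N n) \<longlonglongrightarrow> 0" for c
      by (rule tendsto_divide_0[OF tendsto_const filterlim_at_top_imp_at_infinity]) (unfold N_def, real_asymp)
    have l3: "(\<lambda>n. c / ln (N n)) \<longlonglongrightarrow> 0" for c
      by (rule tendsto_divide_0[OF tendsto_const filterlim_at_top_imp_at_infinity]) (unfold N_def, real_asymp)
    have l4: "(\<lambda>n. g n * r n * (N n)\<^sup>2) \<longlonglongrightarrow> 0" unfolding g_def r_def N_def by real_asymp
    have l5': "(\<lambda>n. (2 * real n powr (2 / 5) + 3)\<^sup>2 * (1 / real n)) \<longlonglongrightarrow> 0" by real_asymp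
    have l5: "(\<lambda>n. (2 * real (k n) + 1)\<^sup>2 * (1 / real n)) \<longlonglongrightarrow> 0"
      by (rule tendsto_sandwich[OF _ _ tendsto_const l5'], simp,
          intro always_eventually allI mult_right_mono k_sq, simp)
    have l6': "(\<lambda>n. (2 * real n powr (2 / 5) + 3)\<^sup>2 * exp (- h n)) \<longlonglongrightarrow> 0" unfolding h_def by real_asymp
    have l6: "(\<lambda>n. (2 * real (k n) + 1)\<^sup>2 * exp (- h n)) \<longlonglongrightarrow> 0"
      by (rule tendsto_sandwich[OF _ _ tendsto_const l6'], simp,
          intro always_eventually allI mult_right_mono k_sq, simp)
    have "err = (\<lambda>n. 64 * W / \<kappa>\<^sup>2 * (1 / (real n * (r n)\<^sup>2))
       + (\<integral>t. env t \<partial>\<mu>) / N n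
       + (\<integral>t. \<bar>l t\<bar> \<partial>\<mu>) / ln (N n)
       + v * (g n * r n * (N n)\<^sup>2)
       + 4 * v / \<kappa>\<^sup>2 * ((2 * real (k n) + 1)\<^sup>2 * (1 / real n))
       + 2 * exp (1 + v) * ((2 * real (k n) + 1)\<^sup>2 * exp (- h n)))"
      by (simp add: err_def fun_eq_iff exp_diff exp_minus divide_inverse mult_ac)
    also have "\<dots> \<longlonglongrightarrow> 0"
      by (intro tendsto_add_zero tendsto_mult_right_zero l1 l2 l3 l4 l5 l6)
    finally show ?thesis .
  qed
  have ev_lam: "\<exists>C. \<forall>\<^sub>F n in sequentially. lam n > 0 \<and> R n \<le> C * lam n"
  proof -
    have lp: "\<forall>\<^sub>F n in sequentially. 0 < lam n" and ls: "limsup (\<lambda>n. ereal (R n / lam n)) < \<infinity>"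
      using lam_order unfolding asymp_equiv_order_def asymp_lesssim_def R_def by auto
    obtain C :: real where C: "limsup (\<lambda>n. ereal (R n / lam n)) < ereal C"
      using ereal_dense2[OF ls] by blast
    have "\<forall>\<^sub>F n in sequentially. ereal (R n / lam n) < ereal C"
      by (rule Limsup_lessD[OF C])
    with lp have "\<forall>\<^sub>F n in sequentially. lam n > 0 \<and> R n \<le> C * lam n"
      by eventually_elim (auto simp: divide_less_eq)
    then show ?thesis by blast
  qed
  then obtain C where C: "\<forall>\<^sub>F n in sequentially. lam n > 0 \<and> R n \<le> C * lam n" by blast
  \<comment> \<open>Since \<open>e <= 3\<close>, this ensures \<open>ln p >= 1\<close>; it also puts
    \<open>1 / p\<close> strictly between 0 and 1, as the quantile bound requires of
    \<alpha>.\<close>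
  have ev_p: "\<forall>\<^sub>F n in sequentially. p n \<ge> 3"
    using p_lim by (simp add: filterlim_at_top)
  \<comment> \<open>The threshold \<open>1 / \<Lambda>x^2\<close> cancels the eigenvalue, leaving
    \<open>smax * R * Kx^2 < \<eta>^2\<close>.\<close>
  have ev_K: "\<forall>\<^sub>F n in sequentially. smax n * R n * (Kx n)\<^sup>2 / \<Lambda>x\<^sup>2 / (\<eta> n)\<^sup>2 < 1 / \<Lambda>x\<^sup>2"
    using eta_order Lambda_pos unfolding asymp_ll_def R_def
    by (intro order_tendstoD(2)[where y = 0]) auto
  have ev_r: "\<forall>\<^sub>F n in sequentially. r n < min m0 \<delta>"
  proof -
    have "r \<longlonglongrightarrow> 0" unfolding r_def[abs_def] by real_asymp
    then show ?thesis using m0 \<delta> by (intro order_tendstoD(2)[where y = 0]) auto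
  qed
  have ev_N: "\<forall>\<^sub>F n in sequentially. 12 * C \<le> N n"
  proof -
    have "filterlim N at_top sequentially" unfolding N_def[abs_def] by real_asymp
    then show ?thesis by (simp add: filterlim_at_top)
  qed
  have ev_Nk: "\<forall>\<^sub>F n in sequentially. N n / real n powr (2 / 5) < \<kappa> / 4"
  proof -
    have "(\<lambda>n. N n / real n powr (2 / 5)) \<longlonglongrightarrow> 0" unfolding N_def[abs_def] by real_asymp
    then show ?thesis using \<kappa> by (intro order_tendstoD(2)[where y = 0]) auto
  qed
  have ev_h: "\<forall>\<^sub>F n in sequentially. 1 + v \<le> h n"
  proof -
    have "filterlim h at_top sequentially" unfolding h_def[abs_def] by real_asymp
    then show ?thesis by (simp add: filterlim_at_top)
  qed
  have ev_rg: "\<forall>\<^sub>F n in sequentially. 4 * r n * g n \<le> 1" unfolding r_def g_def by real_asymp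
  have good: "\<forall>\<^sub>F n in sequentially. n \<ge> 1 \<and> (\<exists>E\<in>sets M.
      E \<subseteq> {\<omega> \<in> space M. \<forall>j\<in>{1..<p n}. \<beta>hat n \<omega> j = 0} \<and> measure M E \<ge> 1 - \<alpha> n - err n)"
    using C ev_p ev_K ev_r ev_N ev_Nk ev_h ev_rg eventually_ge_at_top[of 2]
  proof eventually_elim
    case (elim n)
    have n: "n \<ge> 1" and n2: "real n > 1" using elim by auto
    have p1: "p n \<ge> 1" using elim by simp
    have log_p: "1 \<le> ln (real (p n))"
    proof -
      have "exp 1 \<le> real (p n)" using exp_le elim(2) by (meson numeral_le_real_of_nat_iff order_trans)
      then show ?thesis using p1 by (simp add: ln_ge_iff)
    qed
    have kpos: "real (k n) > 0" using k_ge[of n] n2 by (smt (verit) powr_gt_zero)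
    have \<eta>: "0 < \<eta> n" "\<eta> n < 1" using eta_range[OF n] by auto
    have K: "Kx n \<ge> 1" by (rule Kx_ge[OF n])
    have R_ge: "1 / sqrt (real n) \<le> R n"
      using log_p n by (simp add: R_def real_sqrt_divide divide_right_mono)
    have g_sq: "(g n)\<^sup>2 = sqrt (real n)"
      using n2 by (simp add: g_def power2_eq_square powr_add[symmetric] powr_half_sqrt)
    \<comment> \<open>With \<open>smax >= 1\<close> and \<open>R >= 1 / sqrt n\<close> the order
      condition gives \<open>Kx^2 / sqrt n < \<eta>^2\<close>, and
      \<open>g^2 = sqrt n\<close>.\<close>
    have Kg: "Kx n \<le> \<eta> n * g n"
    proof (rule power2_le_imp_le)
      have "1 * (R n * (Kx n)\<^sup>2) \<le> smax n * (R n * (Kx n)\<^sup>2)"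
        using smax_ge[OF n] log_p by (intro mult_right_mono) (auto simp: R_def)
      also have "\<dots> < (\<eta> n)\<^sup>2"
        using elim(3) \<eta> Lambda_pos by (simp add: field_simps)
      finally have "R n * (Kx n)\<^sup>2 < (\<eta> n)\<^sup>2" by simp
      moreover have "1 / sqrt (real n) * (Kx n)\<^sup>2 \<le> R n * (Kx n)\<^sup>2" using R_ge by (intro mult_right_mono) auto
      ultimately have "1 / sqrt (real n) * (Kx n)\<^sup>2 < (\<eta> n)\<^sup>2" by linarith
      then show "(Kx n)\<^sup>2 \<le> (\<eta> n * g n)\<^sup>2"
        using n2 by (simp add: power_mult_distrib g_sq divide_less_eq)
    qed (use \<eta> in \<open>simp add: g_def\<close>)
    have Nk: "N n < \<kappa> * real (k n) / 4"
    proof -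
      have "N n < \<kappa> / 4 * real n powr (2 / 5)" using elim(6) n2 by (simp add: divide_less_eq)
      also have "\<dots> \<le> \<kappa> / 4 * real (k n)" using k_ge \<kappa> by (intro mult_left_mono) auto
      finally show ?thesis by simp
    qed
    have mesh: "g n * N n ^ 3 * (r n / real (k n)) \<le> 1 / sqrt (real n)"
    proof -
      have "g n * N n ^ 3 * (r n / real (k n)) \<le> g n * N n ^ 3 * (r n / real n powr (2 / 5))"
        using k_ge[of n] n2 by (intro mult_left_mono divide_left_mono mult_pos_pos kpos)
          (auto simp: g_def N_def r_def)
      \<comment> \<open>The exponents are \<open>1/4 + 3/100 - 2/5 - 2/5\<close>, just below
        \<open>-1/2\<close>.\<close>
      also have "\<dots> = real n powr (- 52 / 100)"
        using n2 by (simp add: g_def N_def r_def powr_power powr_add[symmetric] powr_diff[symmetric])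
      also have "\<dots> \<le> real n powr (- 1 / 2)" using n2 by (intro powr_mono) auto
      also have "\<dots> = 1 / sqrt (real n)" using powr_minus_divide[of "real n" "1 / 2"] n2 by (simp add: powr_half_sqrt)
      finally show ?thesis .
    qed
    have h_eq: "h n = 1 / ((N n)\<^sup>2 * g n * r n)"
      using n2 by (simp add: h_def N_def g_def r_def powr_power powr_add[symmetric] powr_minus_divide[symmetric])
    have growth': "\<kappa> * (r n)\<^sup>2 \<le> (\<integral>t. rem c d t \<partial>\<mu>)" if "max \<bar>c\<bar> \<bar>d - 1\<bar> = r n" for c d
      using growth[of c d] that elim(4) by simp
    have y': "y n i \<omega> = \<beta>star n 0 + \<xi> i \<omega>" if "i < n" "\<omega> \<in> space M" for i \<omega>
    proof -
      have "{..<p n} = insert 0 {1..<p n}" using p1 by auto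
      then have "lin_pred (p n) (x n i) (\<beta>star n) = \<beta>star n 0"
        using H0[OF n] intercept[OF n that(1)] by (simp add: lin_pred_def)
      then show ?thesis using model[OF n that] sigma_star by simp
    qed
    define q where "q = Finv n (1 - \<alpha> n)"
    have q_lam: "q \<le> (1 - \<eta> n) * lam n"
      using lam_ge[OF n] \<eta> by (simp add: q_def divide_le_eq mult.commute)
    have \<alpha>01: "0 < 1 - \<alpha> n" "1 - \<alpha> n < 1"
      using alpha n elim(2) by (auto simp: divide_less_eq)
    have star: "1 - \<alpha> n \<le> P.prob {\<omega> \<in> space M. lambda_star f n (p n) (x n) (\<lambda>i. \<xi> i \<omega>) \<le> q}"
      unfolding q_def quantile[OF n] by (rule P.prob_le_quantile_fun[OF lambda_star_measurable \<alpha>01])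
    have r_pos: "0 < r n" "r n \<le> m0" using n2 elim(4) by (auto simp: r_def)
    have k1: "k n \<ge> 1" using kpos by simp
    have g_pos: "g n > 0" using n2 by (simp add: g_def)
    have N1: "N n > 1" using n2 by (simp add: N_def)
    have RC: "sqrt (ln (real (p n)) / real n) \<le> C * lam n" using elim(1) by (simp add: R_def)
    note rate = null_selection_rate[of n "p n" "r n" "k n" "x n" "Kx n" "y n" "\<beta>star n 0" \<kappa> "\<eta> n" "g n" "N n" C
        "lam n" q "h n", folded v_def W_def,
        OF n p1 r_pos k1 intercept[OF n] x_bound[OF n] K centered[OF n] y' \<kappa> growth' \<eta> g_pos Kg N1 elim(5) Nk
          mesh elim(8) log_p conjunct1[OF elim(1)] RC q_lam h_eq elim(7)]
    obtain E where E: "E \<in> sets M"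
      and min: "\<And>\<omega>. \<omega> \<in> E \<Longrightarrow> \<exists>\<theta>. is_exp_lasso l n (p n) (x n) (\<lambda>i. y n i \<omega>) (lam n) \<theta>"
      and zero: "\<And>\<omega> \<beta> \<sigma> j. \<omega> \<in> E \<Longrightarrow> is_exp_lasso l n (p n) (x n) (\<lambda>i. y n i \<omega>) (lam n) (\<beta>, \<sigma>) \<Longrightarrow>
        j \<in> {1..<p n} \<Longrightarrow> \<beta> j = 0"
      and PE: "P.prob {\<omega> \<in> space M. lambda_star f n (p n) (x n) (\<lambda>i. \<xi> i \<omega>) \<le> q} - err n \<le> P.prob E"
      using rate unfolding err_def by blast
    have "E \<subseteq> {\<omega> \<in> space M. \<forall>j\<in>{1..<p n}. \<beta>hat n \<omega> j = 0}"
    proof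
      fix \<omega> assume \<omega>: "\<omega> \<in> E"
      then have sp: "\<omega> \<in> space M" using sets.sets_into_space[OF E] by blast
      show "\<omega> \<in> {\<omega> \<in> space M. \<forall>j\<in>{1..<p n}. \<beta>hat n \<omega> j = 0}"
        using zero[OF \<omega> estimator[OF n sp min[OF \<omega>]]] sp by simp
    qed
    moreover have "measure M E \<ge> 1 - \<alpha> n - err n" using PE star by linarith
    ultimately show ?case using E n by blast
  qed
  \<comment> \<open>Where the bound with \<open>err\<close> fails, which is only for finitely many
    \<open>n\<close>, the value \<open>-1\<close> makes the required probability at most 0, and
    \<open>E = {}\<close> serves.\<close>
  define \<epsilon> where "\<epsilon> n = (if \<exists>E\<in>sets M. E \<subseteq> {\<omega> \<in> space M. \<forall>j\<in>{1..<p n}. \<beta>hat n \<omega> j = 0} \<and>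
      measure M E \<ge> 1 - \<alpha> n - err n then - err n else -1)" for n
  have "(\<lambda>n. - err n) \<longlonglongrightarrow> 0" using tendsto_minus[OF err_lim] by simp
  moreover have "\<forall>\<^sub>F n in sequentially. - err n = \<epsilon> n"
    using good by eventually_elim (auto simp: \<epsilon>_def)
  ultimately have "\<epsilon> \<longlonglongrightarrow> 0" using tendsto_cong by fast
  moreover have "\<exists>E\<in>sets M. E \<subseteq> {\<omega> \<in> space M. \<forall>j\<in>{1..<p n}. \<beta>hat n \<omega> j = 0} \<and>
      measure M E \<ge> 1 - \<alpha> n + \<epsilon> n" if n: "n \<ge> 1" for n
  proof (cases "\<exists>E\<in>sets M. E \<subseteq> {\<omega> \<in> space M. \<forall>j\<in>{1..<p n}. \<beta>hat n \<omega> j = 0} \<and>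
      measure M E \<ge> 1 - \<alpha> n - err n")
    case True
    then show ?thesis by (auto simp: \<epsilon>_def)
  next
    case False
    then have "\<epsilon> n = - 1" unfolding \<epsilon>_def by (rule if_not_P)
    moreover have "\<alpha> n \<ge> 0" using alpha n by auto
    ultimately have "1 - \<alpha> n + \<epsilon> n \<le> measure M {}" by simp
    then show ?thesis by (intro bexI[of _ "{}"]) auto
  qed
  ultimately show ?thesis by blast
qed

end
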